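(* Let $p\ge 3$ be a prime number and let $k\ge 1$, $n\ge 1$ be integers. Put $N_{(k,n)}=\dfrac{p^{2kn}-1}{p^{2k}-1}$. Then $M_{p^{kn}}(\mathbb{C})$ contains $N_{(k,n)}$ pairwise quasi-orthogonal subalgebras, each of which is isomorphic to $M_{p^k}(\mathbb{C})$.
   Context: $M_m(\mathbb{C})$ is the algebra of complex $m\times m$ matrices with the usual trace $\mathrm{Tr}$ and the inner product $\langle A,B\rangle=\mathrm{Tr}(A^*B)$. A subalgebra always means a unital $*$-subalgebra (contains the identity $I$ and is closed under adjoint); isomorphism means isomorphism of $*$-algebras. Two subalgebras $\mathcal{A}_1,\mathcal{A}_2$ of $M_m(\mathbb{C})$ are quasi-orthogonal if $\mathcal{A}_1\ominus\mathbb{C}I\perp\mathcal{A}_2\ominus\mathbb{C}I$, where $\mathcal{A}\ominus\mathbb{C}I$ denotes the orthogonal complement of $\mathbb{C}I$ in $\mathcal{A}$. Pairwise quasi-orthogonal means that any two different members of the family are quasi-orthogonal (the members being distinct subalgebras). *)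

theory Defs
  imports
    "Jordan_Normal_Form.Schur_Decomposition"
    "HOL-Computational_Algebra.Primes"
begin

text \<open>
  The algebra of complex \<open>m \<times> m\<close> matrices is \<^term>\<open>carrier_mat m m :: complex mat set\<close>, and
  \<^const>\<open>mat_adjoint\<close> is the conjugate transpose.
\<close>

definition mat_trace :: "complex mat \<Rightarrow> complex" where
  "mat_trace A = (\<Sum>i<dim_row A. A $$ (i, i))"

definition trace_inner :: "complex mat \<Rightarrow> complex mat \<Rightarrow> complex" where
  "trace_inner A B = mat_trace (mat_adjoint A * B)"

definition star_subalgebra :: "nat \<Rightarrow> complex mat set \<Rightarrow> bool" where
  "star_subalgebra m \<A> \<longleftrightarrow>
     \<A> \<subseteq> carrier_mat m m \<and>
     1\<^sub>m m \<in> \<A> \<and>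
     (\<forall>A\<in>\<A>. \<forall>B\<in>\<A>. A + B \<in> \<A>) \<and>
     (\<forall>c. \<forall>A\<in>\<A>. c \<cdot>\<^sub>m A \<in> \<A>) \<and>
     (\<forall>A\<in>\<A>. \<forall>B\<in>\<A>. A * B \<in> \<A>) \<and>
     (\<forall>A\<in>\<A>. mat_adjoint A \<in> \<A>)"

text \<open>
  The two sets may consist of matrices of different sizes. Preservation of the unit is not
  listed: it follows from surjectivity and multiplicativity whenever both sets are
  \<open>star_subalgebra\<close>s.
\<close>

definition star_isomorphism ::
  "complex mat set \<Rightarrow> complex mat set \<Rightarrow> (complex mat \<Rightarrow> complex mat) \<Rightarrow> bool" where
  "star_isomorphism \<A> \<B> \<phi> \<longleftrightarrow>
     bij_betw \<phi> \<A> \<B> \<and>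
     (\<forall>A\<in>\<A>. \<forall>B\<in>\<A>. \<phi> (A + B) = \<phi> A + \<phi> B) \<and>
     (\<forall>c. \<forall>A\<in>\<A>. \<phi> (c \<cdot>\<^sub>m A) = c \<cdot>\<^sub>m \<phi> A) \<and>
     (\<forall>A\<in>\<A>. \<forall>B\<in>\<A>. \<phi> (A * B) = \<phi> A * \<phi> B) \<and>
     (\<forall>A\<in>\<A>. \<phi> (mat_adjoint A) = mat_adjoint (\<phi> A))"

definition star_isomorphic :: "complex mat set \<Rightarrow> complex mat set \<Rightarrow> bool" where
  "star_isomorphic \<A> \<B> \<longleftrightarrow> (\<exists>\<phi>. star_isomorphism \<A> \<B> \<phi>)"

definition scalar_mats :: "nat \<Rightarrow> complex mat set" where
  "scalar_mats m = {c \<cdot>\<^sub>m 1\<^sub>m m |c. True}"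

definition orth_compl_in :: "complex mat set \<Rightarrow> complex mat set \<Rightarrow> complex mat set" where
  "orth_compl_in \<A> \<S> = {A \<in> \<A>. \<forall>S\<in>\<S>. trace_inner S A = 0}"

definition quasi_orthogonal :: "nat \<Rightarrow> complex mat set \<Rightarrow> complex mat set \<Rightarrow> bool" where
  "quasi_orthogonal m \<A> \<B> \<longleftrightarrow>
     (\<forall>A \<in> orth_compl_in \<A> (scalar_mats m).
      \<forall>B \<in> orth_compl_in \<B> (scalar_mats m). trace_inner A B = 0)"

definition N_sub :: "nat \<Rightarrow> nat \<Rightarrow> nat \<Rightarrow> nat" where
  "N_sub p k n = (p ^ (2 * k * n) - 1) div (p ^ (2 * k) - 1)"

text \<open>The integer division and the truncated subtractions in \<^const>\<open>N_sub\<close> are exact.\<close>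

lemma real_N_sub:
  assumes "p \<ge> 2" "k \<ge> 1"
  shows "real (N_sub p k n) = (real p ^ (2 * k * n) - 1) / (real p ^ (2 * k) - 1)"
proof -
  define q where "q = p ^ (2 * k)"
  have q: "q > 1" unfolding q_def using assms by (intro one_less_power) auto
  have "int q - 1 dvd int q ^ n - 1"
    by (metis dvd_triv_left power_diff_1_eq)
  moreover have "int (q - 1) = int q - 1" "int (q ^ n - 1) = int q ^ n - 1"
    using q by (auto simp: of_nat_diff)
  ultimately have "q - 1 dvd q ^ n - 1" by (metis int_dvd_int_iff)
  then have "real ((q ^ n - 1) div (q - 1)) = real (q ^ n - 1) / real (q - 1)"
    by (rule real_of_nat_div)
  also have "\<dots> = (real q ^ n - 1) / (real q - 1)"
    using q by (simp add: of_nat_diff)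
  finally show ?thesis by (simp add: N_sub_def q_def power_mult)
qed

end

theory Submission
  imports Defs "HOL-Library.Product_Plus"
begin

text \<open>
  Let \<open>q = p\<^sup>k\<close>. A Weyl system with parameter \<open>c \<noteq> 0\<close> is a family of unitaries \<open>W u\<close>, \<open>u \<in> F\<^sub>q\<^sup>2\<close>,
  whose trace vanishes for \<open>u \<noteq> 0\<close> and which multiply by \<open>W u W v = \<psi>(c [u, v]) W (u + v)\<close>, where
  \<open>[u, v]\<close> is the symplectic form and \<open>\<psi>\<close> a nontrivial additive character. Its span is a copy of the
  algebra of \<open>q \<times> q\<close> matrices. Starting from the empty family, \<open>r\<close> pairwise
  quasi-orthogonal systems are turned into \<open>r q\<^sup>2 + 1\<close> by tensoring with \<open>q \<times> q\<close> matrices: identify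
  \<open>F\<^sub>q\<^sup>2\<close> with the field with \<open>q\<^sup>2\<close> elements, replace each \<open>W\<close> by the \<open>q\<^sup>2\<close> systems \<open>W u \<otimes> S (a u)\<close>
  with \<open>S\<close> the standard system of parameter 1, and add \<open>1 \<otimes> S u\<close>. The new parameter \<open>c + N(a)\<close>,
  with \<open>N\<close> the norm, may vanish; in that case \<open>a u\<close> is replaced by \<open>a u\<^sup>*\<close> with the conjugate \<open>u\<^sup>*\<close>,
  which gives \<open>c - N(a) = 2 c \<noteq> 0\<close>. Comparing norms shows that different \<open>a\<close> still give
  transversal graphs.
\<close>

section \<open>Finite fields and additive characters\<close>

definition submodule_over :: "'r::comm_ring_1 set \<Rightarrow> 'r set \<Rightarrow> bool" where
  "submodule_over A H \<longleftrightarrow> 0 \<in> H \<and> (\<forall>x\<in>H. \<forall>y\<in>H. x + y \<in> H) \<and> (\<forall>a\<in>A. \<forall>x\<in>H. a * x \<in> H)"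

text \<open>
  Over \<open>A = UNIV\<close> this yields maximal ideals; over the integers it yields an additive subgroup of prime
  index, hence an additive character.
\<close>

lemma maximal_submodule_avoiding_one:
  fixes A H0 :: "'r::comm_ring_1 set"
  assumes A: "0 \<in> A" "1 \<in> A" "\<And>a b. a \<in> A \<Longrightarrow> b \<in> A \<Longrightarrow> a + b \<in> A"
      "\<And>a b. a \<in> A \<Longrightarrow> b \<in> A \<Longrightarrow> a * b \<in> A"
    and H0: "submodule_over A H0" "1 \<notin> H0"
  obtains H where "submodule_over A H" "H0 \<subseteq> H" "1 \<notin> H"
    "\<And>g. g \<notin> H \<Longrightarrow> \<exists>a\<in>A. 1 - a * g \<in> H"
proof -
  let ?C = "{H. submodule_over A H \<and> H0 \<subseteq> H \<and> 1 \<notin> H}"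
  have "\<exists>H\<in>?C. \<forall>X\<in>?C. H \<subseteq> X \<longrightarrow> X = H"
  proof (rule subset_Zorn_nonempty)
    show "?C \<noteq> {}" using H0 by auto
    fix \<C> assume ne: "\<C> \<noteq> {}" and ch: "subset.chain ?C \<C>"
    have mem: "X \<in> ?C" if "X \<in> \<C>" for X using ch that by (auto simp: subset.chain_def)
    have tot: "X \<subseteq> Y \<or> Y \<subseteq> X" if "X \<in> \<C>" "Y \<in> \<C>" for X Y
      using ch that by (auto simp: subset.chain_def)
    have "submodule_over A (\<Union>\<C>)"
      unfolding submodule_over_def
    proof (intro conjI ballI)
      show "0 \<in> \<Union>\<C>" using ne mem by (auto simp: submodule_over_def)
    next
      fix x y assume "x \<in> \<Union>\<C>" "y \<in> \<Union>\<C>"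
      then obtain X Y where XY: "X \<in> \<C>" "Y \<in> \<C>" "x \<in> X" "y \<in> Y" by auto
      with tot[of X Y] obtain Z where "Z \<in> \<C>" "x \<in> Z" "y \<in> Z" by auto
      then show "x + y \<in> \<Union>\<C>" using mem[of Z] by (auto simp: submodule_over_def)
    next
      fix a x assume "a \<in> A" "x \<in> \<Union>\<C>"
      then show "a * x \<in> \<Union>\<C>" using mem unfolding submodule_over_def by blast
    qed
    then show "\<Union>\<C> \<in> ?C" using ne mem by auto
  qed
  then obtain H where HC: "H \<in> ?C" and max: "\<forall>X\<in>?C. H \<subseteq> X \<longrightarrow> X = H" by (rule bexE)
  from HC have H: "submodule_over A H" "H0 \<subseteq> H" "1 \<notin> H" by auto
  have "\<exists>a\<in>A. 1 - a * g \<in> H" if g: "g \<notin> H" for g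
  proof -
    let ?H = "{h + a * g | h a. h \<in> H \<and> a \<in> A}"
    define K where "K = ?H"
    have "submodule_over A ?H"
      unfolding submodule_over_def
    proof (intro conjI ballI)
      have "0 = 0 + 0 * g" by simp
      then show "0 \<in> ?H" using H(1) A(1) unfolding submodule_over_def by blast
    next
      fix x y assume "x \<in> ?H" "y \<in> ?H"
      then obtain h a h' a' where e: "x = h + a * g" "y = h' + a' * g" "h \<in> H" "h' \<in> H" "a \<in> A" "a' \<in> A"
        by auto
      then have "x + y = (h + h') + (a + a') * g" by (simp add: algebra_simps)
      then show "x + y \<in> ?H" using H(1) A(3) e unfolding submodule_over_def by blast
    next
      fix b x assume "b \<in> A" "x \<in> ?H"
      then obtain h a where e: "x = h + a * g" "h \<in> H" "a \<in> A" by auto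
      then have "b * x = b * h + (b * a) * g" by (simp add: algebra_simps)
      then show "b * x \<in> ?H" using H(1) A(4) e \<open>b \<in> A\<close> unfolding submodule_over_def by blast
    qed
    moreover have sub: "H \<subseteq> ?H"
    proof
      fix h assume "h \<in> H"
      moreover have "h = h + 0 * g" by simp
      ultimately show "h \<in> ?H" using A(1) by blast
    qed
    moreover have "g \<in> ?H"
    proof -
      have "g = 0 + 1 * g" by simp
      then show ?thesis using A(2) H(1) unfolding submodule_over_def by blast
    qed
    ultimately have "submodule_over A K" "H \<subseteq> K" "g \<in> K" unfolding K_def .
    then have "1 \<in> K" using max g H(2) by blast
    then obtain h a where "1 = h + a * g" "h \<in> H" "a \<in> A" unfolding K_def by blast
    then show ?thesis by (metis add_diff_cancel_right')
  qed
  with H show thesis using that by blast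
qed

text \<open>For \<open>0 < i < p\<close> the coefficient \<open>p choose i\<close> is divisible by
  \<open>p\<close>, which settles a single p-th power. The induction on \<open>k\<close> then goes
  through because \<open>Z - (X + Y)\<close> divides \<open>Z ^ p - (X + Y) ^ p\<close>.\<close>

lemma frobenius_mod_ideal:
  fixes x y :: "'r::comm_ring_1"
  assumes p: "prime p" and M: "submodule_over UNIV M" "of_nat p \<in> M"
  shows "(x + y) ^ (p ^ k) - (x ^ (p ^ k) + y ^ (p ^ k)) \<in> M"
proof (induction k)
  case 0
  then show ?case using M by (simp add: submodule_over_def)
next
  case (Suc k)
  have M0: "0 \<in> M" and Madd: "\<And>a b. a \<in> M \<Longrightarrow> b \<in> M \<Longrightarrow> a + b \<in> M"
    and Mmult: "\<And>a b. b \<in> M \<Longrightarrow> a * b \<in> M"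
    using M by (auto simp: submodule_over_def)
  have Msum: "sum f I \<in> M" if "\<And>i. i \<in> I \<Longrightarrow> f i \<in> M" for f :: "nat \<Rightarrow> 'r" and I
    using that by (induction I rule: infinite_finite_induct) (auto intro: M0 Madd)
  have frob: "(a + b) ^ p - (a ^ p + b ^ p) \<in> M" for a b :: 'r
  proof -
    have p0: "p > 0" using p prime_gt_0_nat by blast
    have "{..p} = insert 0 (insert p {1..<p})" using p0 by auto
    then have "(a + b) ^ p = a ^ p + b ^ p + (\<Sum>i\<in>{1..<p}. of_nat (p choose i) * a ^ i * b ^ (p - i))"
      unfolding binomial_ring using p0 by (simp add: algebra_simps)
    moreover have "(\<Sum>i\<in>{1..<p}. of_nat (p choose i) * a ^ i * b ^ (p - i)) \<in> M"
    proof (rule Msum)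
      fix i assume "i \<in> {1..<p}"
      then have "p dvd (p choose i)" by (intro dvd_choose_prime) (use p in auto)
      then obtain c where "p choose i = c * p" by (metis dvdE mult.commute)
      then have "of_nat (p choose i) * a ^ i * b ^ (p - i) = (of_nat c * a ^ i * b ^ (p - i)) * of_nat p"
        by (simp add: algebra_simps)
      then show "of_nat (p choose i) * a ^ i * b ^ (p - i) \<in> M" using Mmult[OF M(2)] by metis
    qed
    ultimately show ?thesis by simp
  qed
  define X Y Z where "X = x ^ (p ^ k)" "Y = y ^ (p ^ k)" "Z = (x + y) ^ (p ^ k)"
  have "Z - (X + Y) \<in> M" using Suc by (simp add: X_Y_Z_def)
  moreover have "(Z - (X + Y)) dvd (Z ^ p - (X + Y) ^ p)"
    by (metis dvd_triv_left power_diff_sumr2)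
  ultimately have "Z ^ p - (X + Y) ^ p \<in> M" using Mmult by (metis dvdE mult.commute)
  from Madd[OF this frob[of X Y]] have "Z ^ p - (X ^ p + Y ^ p) \<in> M"
    by (simp only: diff_add_cancel add_diff_eq)
  then show ?case by (simp add: X_Y_Z_def flip: power_mult) (simp add: mult.commute)
qed

text \<open>Such a \<open>y\<close> is a root of the characteristic polynomial of \<open>C\<close>,
  which is monic with integer coefficients.\<close>

lemma algebraic_int_of_int_mat_eigenvalue:
  fixes C :: "nat \<Rightarrow> nat \<Rightarrow> int" and v :: "nat \<Rightarrow> complex"
  assumes "\<And>i. i < n \<Longrightarrow> (\<Sum>j<n. of_int (C i j) * v j) = y * v i" and "l < n" "v l \<noteq> 0"
  shows "algebraic_int y"
proof -
  let ?A = "mat n n (\<lambda>(i, j). C i j)"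
  let ?B = "map_mat of_int ?A :: complex mat"
  have A: "?A \<in> carrier_mat n n" and B: "?B \<in> carrier_mat n n" by auto
  have "eigenvector ?B (vec n v) y"
    unfolding eigenvector_def
  proof (intro conjI)
    show "vec n v \<noteq> 0\<^sub>v (dim_row ?B)" using assms(2,3) by (metis index_vec index_zero_vec(1) dim_row_mat(1) index_map_mat(2))
    show "?B *\<^sub>v vec n v = y \<cdot>\<^sub>v vec n v"
      by (rule eq_vecI) (auto simp: scalar_prod_def assms(1) lessThan_atLeast0[symmetric])
  qed simp
  then have "eigenvalue ?B y" unfolding eigenvalue_def by blast
  then have "poly (char_poly ?B) y = 0" using eigenvalue_root_char_poly[OF B] by simp
  then have "poly (of_int_poly (char_poly ?A)) y = 0" by (simp only: of_int_hom.char_poly_hom[OF A])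
  moreover have "lead_coeff (char_poly ?A) = 1" using degree_monic_char_poly[OF A] by simp
  ultimately show ?thesis unfolding algebraic_int_altdef_ipoly by blast
qed

text \<open>Multiplication by the value of \<open>f\<close> maps integer combinations of the first
  \<open>m\<close> powers of \<open>\<zeta>\<close> to such combinations, so the vector of these
  powers is an eigenvector of an integer matrix.\<close>

lemma int_combination_of_roots_of_unity_algebraic_int:
  fixes \<zeta> :: complex and f :: "int poly"
  assumes "\<zeta> ^ m = 1" "m > 0"
  shows "algebraic_int (poly (of_int_poly f) \<zeta>)"
proof (rule algebraic_int_of_int_mat_eigenvalue)
  \<comment> \<open>\<open>?C i j\<close> collects the coefficients of those terms of
    \<open>f\<close> that carry \<open>\<zeta> ^ i\<close> to \<open>\<zeta> ^ j\<close>, exponents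
    being read modulo \<open>m\<close>.\<close>
  let ?C = "\<lambda>i j. \<Sum>k | k \<le> degree f \<and> (k + i) mod m = j. coeff f k"
  have red: "\<zeta> ^ (r mod m) = \<zeta> ^ r" for r
  proof -
    have "\<zeta> ^ r = \<zeta> ^ (m * (r div m) + r mod m)" by simp
    also have "\<dots> = \<zeta> ^ (r mod m)" unfolding power_add power_mult by (simp add: assms)
    finally show ?thesis by simp
  qed
  fix i assume "i < m"
  have "(\<Sum>j<m. of_int (?C i j) * \<zeta> ^ j) =
      (\<Sum>j<m. \<Sum>k | k \<in> {..degree f} \<and> (k + i) mod m = j. of_int (coeff f k) * \<zeta> ^ (k + i))"
    by (auto simp: sum_distrib_right intro!: sum.cong) (metis red)
  also have "\<dots> = (\<Sum>k\<le>degree f. of_int (coeff f k) * \<zeta> ^ (k + i))"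
    by (rule sum.group) (use assms in auto)
  also have "\<dots> = poly (of_int_poly f) \<zeta> * \<zeta> ^ i"
    by (simp add: poly_altdef sum_distrib_right power_add mult.assoc)
  finally show "(\<Sum>j<m. of_int (?C i j) * \<zeta> ^ j) = poly (of_int_poly f) \<zeta> * \<zeta> ^ i" .
qed (use assms in auto)

text \<open>
  The field is a residue field of the ring of integer polynomials evaluated at a primitive
  \<open>(p\<^sup>k - 1)\<close>-th root of unity \<open>\<zeta>\<close>. Above \<open>p\<close> there is a maximal ideal because \<open>1 / p\<close> is not an
  algebraic integer, and by Frobenius the powers of \<open>\<zeta>\<close> fill all nonzero residue classes.
\<close>

lemma finite_field_quotient:
  fixes p k :: nat
  assumes p: "prime p" "p \<ge> 3" and k: "k \<ge> 1"
  obtains M :: "int poly set" and rep :: "nat \<Rightarrow> int poly" where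
    "submodule_over UNIV M" "1 \<notin> M" "of_nat p \<in> M"
    "\<And>f. f \<notin> M \<Longrightarrow> \<exists>g. 1 - g * f \<in> M"
    "\<And>f. \<exists>i<p ^ k. f - rep i \<in> M"
    "\<And>i j. i < p ^ k \<Longrightarrow> j < p ^ k \<Longrightarrow> rep i - rep j \<in> M \<Longrightarrow> i = j"
proof -
  define m where "m = p ^ k - 1"
  have "p ^ 1 \<le> p ^ k" using p k by (intro power_increasing) auto
  then have m: "m \<ge> 2" "p ^ k = Suc m" using p by (auto simp: m_def)
  define \<zeta> where "\<zeta> = cis (2 * pi / real m)"
  define ev where "ev f = poly (of_int_poly f) \<zeta>" for f :: "int poly"
  have bij: "bij_betw (\<lambda>k. cis (2 * pi * real k / real m)) {..<m} {z. z ^ m = 1}"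
    using m by (intro bij_betw_roots_unity) auto
  have zpow: "\<zeta> ^ j = cis (2 * pi * real j / real m)" for j
    by (simp add: \<zeta>_def DeMoivre mult_ac)
  have zm: "\<zeta> ^ m = 1" using m by (simp add: zpow)
  have zj: "\<zeta> ^ j \<noteq> 1" if "0 < j" "j < m" for j
    using bij_betw_imp_inj_on[OF bij] that inj_onD[of _ _ j 0] by (fastforce simp: zpow)
  have ev_add: "ev (f + g) = ev f + ev g" and ev_mult: "ev (f * g) = ev f * ev g" for f g
    by (simp_all add: ev_def of_int_poly_hom.hom_add of_int_poly_hom.hom_mult)
  define x :: "int poly" where "x = [:0, 1:]"
  have ev_x: "ev x = \<zeta>" and ev_1: "ev 1 = 1" and ev_0: "ev 0 = 0"
    by (simp_all add: ev_def x_def)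
  have ev_pow: "ev (f ^ n) = ev f ^ n" for f n
    by (induction n) (simp_all add: ev_1 ev_mult)
  have ev_sum: "ev (sum f I) = (\<Sum>i\<in>I. ev (f i))" for f and I :: "nat set"
    by (induction I rule: infinite_finite_induct) (simp_all add: ev_0 ev_add)
  have ev_nat: "ev (of_nat n) = of_nat n" for n
    by (induction n) (simp_all add: ev_0 ev_1 ev_add)
  have ev_minus: "ev (- f) = - ev f" for f
    using ev_add[of f "- f"] ev_0 by (simp add: add_eq_0_iff)
  \<comment> \<open>This is the preimage under \<open>ev\<close> of the multiples of
    \<open>p\<close>. It contains the kernel of \<open>ev\<close>, so every relation satisfied by
    \<open>\<zeta>\<close> holds for \<open>x\<close> modulo a larger ideal.\<close>
  let ?H0 = "{of_nat p * g + h | g h. ev h = 0}"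
  have sub0: "submodule_over UNIV ?H0"
    unfolding submodule_over_def
  proof (intro conjI ballI)
    have "0 = of_nat p * 0 + (0 :: int poly)" by simp
    then show "0 \<in> ?H0" using ev_0 by blast
  next
    fix f f' assume "f \<in> ?H0" "f' \<in> ?H0"
    then obtain g h g' h' where e: "f = of_nat p * g + h" "f' = of_nat p * g' + h'"
      "ev h = 0" "ev h' = 0" by blast
    then have "f + f' = of_nat p * (g + g') + (h + h')" "ev (h + h') = 0"
      by (auto simp: algebra_simps ev_add)
    then show "f + f' \<in> ?H0" by blast
  next
    fix a f assume "f \<in> ?H0"
    then obtain g h where e: "f = of_nat p * g + h" "ev h = 0" by blast
    then have "a * f = of_nat p * (a * g) + a * h" "ev (a * h) = 0"
      by (auto simp: algebra_simps ev_mult)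
    then show "a * f \<in> ?H0" by blast
  qed
  have one0: "1 \<notin> ?H0"
  proof
    assume "1 \<in> ?H0"
    then obtain g h where e: "1 = of_nat p * g + h" "ev h = 0" by blast
    then have "1 = of_nat p * ev g" by (metis ev_1 ev_add ev_mult ev_nat add.right_neutral)
    moreover have "algebraic_int (ev g)"
      unfolding ev_def by (rule int_combination_of_roots_of_unity_algebraic_int[OF zm]) (use m in auto)
    moreover have "ev g \<in> \<rat>"
    proof -
      have "ev g = 1 / of_nat p" using \<open>1 = of_nat p * ev g\<close> p by (simp add: field_simps)
      then show ?thesis by simp
    qed
    ultimately have "ev g \<in> \<int>" using rational_algebraic_int_is_int by blast
    then obtain c where "ev g = of_int c" by (elim Ints_cases)
    with \<open>1 = of_nat p * ev g\<close> have "of_int 1 = (of_int (int p * c) :: complex)" by simp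
    then have "1 = int p * c" unfolding of_int_eq_iff .
    then show False using p by (metis dvd_triv_left int_dvd_int_iff nat_dvd_1_iff_1 not_prime_1 of_nat_1)
  qed
  obtain M where M: "submodule_over UNIV M" "?H0 \<subseteq> M" "1 \<notin> M"
    and inv: "\<And>g. g \<notin> M \<Longrightarrow> \<exists>a\<in>UNIV. 1 - a * g \<in> M"
    using maximal_submodule_avoiding_one[of UNIV ?H0] sub0 one0 by auto
  have M0: "0 \<in> M" and Madd: "\<And>a b. a \<in> M \<Longrightarrow> b \<in> M \<Longrightarrow> a + b \<in> M"
    and Mmult: "\<And>a b. b \<in> M \<Longrightarrow> a * b \<in> M"
    using M by (auto simp: submodule_over_def)
  have Mneg: "- a \<in> M" if "a \<in> M" for a using Mmult[OF that, of "-1"] by simp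
  have Mdiff: "a - b \<in> M" if "a \<in> M" "b \<in> M" for a b using Madd[OF that(1) Mneg[OF that(2)]] by simp
  have Msum: "sum f I \<in> M" if "\<And>i. i \<in> I \<Longrightarrow> f i \<in> M" for f :: "nat \<Rightarrow> int poly" and I
    using that by (induction I rule: infinite_finite_induct) (auto intro: M0 Madd)
  have Mprime: "b \<in> M" if ab: "a * b \<in> M" "a \<notin> M" for a b
  proof -
    obtain c where "1 - c * a \<in> M" using inv[OF ab(2)] by blast
    from Mmult[OF this, of b] have "b - c * (a * b) \<in> M" by (simp add: algebra_simps)
    from Madd[OF this Mmult[OF ab(1), of c]] show ?thesis by simp
  qed
  have Mpow: "a ^ i - 1 \<in> M" if "a - 1 \<in> M" for a and i :: nat
    unfolding power_diff_1_eq by (subst mult.commute) (rule Mmult[OF that])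
  have kerM: "f \<in> M" if "ev f = 0" for f
  proof -
    have "f = of_nat p * 0 + f" by simp
    then show ?thesis using M(2) that by blast
  qed
  have pM: "of_nat p \<in> M"
  proof -
    have "of_nat p = of_nat p * 1 + (0::int poly)" by simp
    then show ?thesis using M(2) ev_0 by blast
  qed
  \<comment> \<open>Modulo \<open>M\<close> the number \<open>m = p ^ k - 1\<close> is congruent to
    \<open>-1\<close>, hence nonzero.\<close>
  have mM: "of_nat m \<notin> M"
  proof
    assume "of_nat m \<in> M"
    moreover have "of_nat (p ^ k) \<in> M"
      using Mmult[OF pM, of "of_nat p ^ (k - 1)"] k by (simp flip: power_Suc2)
    ultimately have "of_nat (p ^ k) - of_nat m \<in> M" by (rule Mdiff[rotated])
    then show False using M(3) m by simp
  qed
  have xm: "x ^ m - 1 \<in> M"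
    by (rule kerM) (simp add: ev_add[of _ "- 1", simplified] ev_minus ev_1 ev_pow ev_x zm)
  have geo: "(\<Sum>i<m. (x ^ j) ^ i) \<in> M" if "0 < j" "j < m" for j
  proof (rule kerM)
    have "(\<zeta> ^ j - 1) * (\<Sum>i<m. (\<zeta> ^ j) ^ i) = (\<zeta> ^ j) ^ m - 1"
      by (simp add: power_diff_1_eq)
    also have "\<dots> = 0" by (metis (no_types, lifting) diff_self power_mult mult.commute zm power_one)
    finally show "ev (\<Sum>i<m. (x ^ j) ^ i) = 0" using zj[OF that] by (simp add: ev_sum ev_pow ev_x)
  qed
  \<comment> \<open>If \<open>x ^ j\<close> were 1 modulo \<open>M\<close>, the geometric sum of
    \<open>geo\<close>, which lies in \<open>M\<close>, would be congruent to its number of terms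
    \<open>m\<close>.\<close>
  have ord: "x ^ j - 1 \<notin> M" if "0 < j" "j < m" for j
  proof
    assume a: "x ^ j - 1 \<in> M"
    have "(\<Sum>i<m. (x ^ j) ^ i - 1) \<in> M"
    proof (rule Msum)
      fix i show "(x ^ j) ^ i - 1 \<in> M" by (rule Mpow[OF a])
    qed
    from Mdiff[OF geo[OF that] this] show False using mM by (simp add: sum_subtractf)
  qed
  \<comment> \<open>Modulo \<open>M\<close> the elements fixed by the \<open>p ^ k\<close>-th power
    form a subring. It contains the integers and, as \<open>p ^ k = m + 1\<close>, also
    \<open>x\<close>, hence all polynomials.\<close>
  have fixed: "f ^ (p ^ k) - f \<in> M" for f
  proof -
    let ?Q = "p ^ k"
    have odd: "odd ?Q" using p prime_odd_nat[of p] by simp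
    have S_add: "(f + g) ^ ?Q - (f + g) \<in> M" if "f ^ ?Q - f \<in> M" "g ^ ?Q - g \<in> M" for f g
      using Madd[OF frobenius_mod_ideal[OF p(1) M(1) pM, of f g k] Madd[OF that]]
      by (simp add: algebra_simps)
    have S_mult: "(f * g) ^ ?Q - (f * g) \<in> M" if "f ^ ?Q - f \<in> M" "g ^ ?Q - g \<in> M" for f g
      using Madd[OF Mmult[OF that(2), of "f ^ ?Q"] Mmult[OF that(1), of g]]
      by (simp add: algebra_simps)
    have S_neg: "(- f) ^ ?Q - (- f) \<in> M" if "f ^ ?Q - f \<in> M" for f
      using Mneg[OF that] odd by (simp add: power_minus_odd)
    have S_1: "1 ^ ?Q - 1 \<in> M" using M0 by simp
    have S_0: "0 ^ ?Q - 0 \<in> M" using M0 m by simp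
    have S_int: "of_int a ^ ?Q - of_int a \<in> M" for a :: int
    proof (induction a rule: int_induct[of _ 0])
      case base
      then show ?case using S_0 by simp
    next
      case (step1 i)
      then show ?case using S_add[OF _ S_1, of "of_int i"] by simp
    next
      case (step2 i)
      then show ?case using S_add[OF _ S_neg[OF S_1], of "of_int i"] by simp
    qed
    have S_x: "x ^ ?Q - x \<in> M"
      using Mmult[OF xm, of x] m by (simp add: algebra_simps)
    show ?thesis
    proof (induction f)
      case 0
      then show ?case using S_0 .
    next
      case (pCons a f)
      have "pCons a f = of_int a + x * f" by (simp add: x_def of_int_poly)
      then show ?case using S_add[OF S_int S_mult[OF S_x pCons(2)]] by simp
    qed
  qed
  \<comment> \<open>Zero and the powers \<open>x ^ 0\<close> to \<open>x ^ (m - 1)\<close> are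
    \<open>m + 1 = p ^ k\<close> representatives.\<close>
  define rep where "rep i = (case i of 0 \<Rightarrow> 0 | Suc j \<Rightarrow> x ^ j)" for i
  have cover: "\<exists>i<p ^ k. f - rep i \<in> M" for f
  proof (cases "f \<in> M")
    case True
    then show ?thesis using m by (intro exI[of _ 0]) (simp add: rep_def)
  next
    case False
    have "f * (f ^ m - 1) \<in> M" using fixed[of f] m by (simp add: algebra_simps)
    then have fm: "f ^ m - 1 \<in> M" using Mprime False by blast
    have "\<exists>i<m. f * x ^ i - 1 \<in> M"
      \<comment> \<open>otherwise every \<open>\<Sum>\<^sub>j (f x\<^sup>i)\<^sup>j\<close> vanishes, but these add up to \<open>m\<close>\<close>
    proof (rule ccontr)
      assume no: "\<not> (\<exists>i<m. f * x ^ i - 1 \<in> M)"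
      have "(\<Sum>j<m. (f * x ^ i) ^ j) \<in> M" if "i < m" for i
      proof (rule Mprime)
        show "f * x ^ i - 1 \<notin> M" using no that by blast
        have "(x ^ m) ^ i - 1 \<in> M" by (rule Mpow[OF xm])
        from Madd[OF Mmult[OF this, of "f ^ m"] fm] have "f ^ m * (x ^ m) ^ i - 1 \<in> M"
          by (simp add: algebra_simps)
        moreover have "f ^ m * (x ^ m) ^ i = (f * x ^ i) ^ m"
          by (simp add: power_mult_distrib mult.commute flip: power_mult)
        ultimately show "(f * x ^ i - 1) * (\<Sum>j<m. (f * x ^ i) ^ j) \<in> M"
          by (simp add: power_diff_1_eq)
      qed
      then have "(\<Sum>i<m. \<Sum>j<m. (f * x ^ i) ^ j) \<in> M" by (intro Msum[of "{..<m}" "\<lambda>i. \<Sum>j<m. (f * x ^ i) ^ j"]) auto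
      also have "(\<Sum>i<m. \<Sum>j<m. (f * x ^ i) ^ j) = (\<Sum>j<m. \<Sum>i<m. (f * x ^ i) ^ j)"
        by (rule sum.swap)
      also have "\<dots> = (\<Sum>j<m. f ^ j * (\<Sum>i<m. (x ^ j) ^ i))"
        by (simp add: power_mult_distrib sum_distrib_left mult.commute flip: power_mult)
      also have "\<dots> = of_nat m + (\<Sum>j\<in>{1..<m}. f ^ j * (\<Sum>i<m. (x ^ j) ^ i))"
      proof -
        have "{..<m} = insert 0 {1..<m}" using m by auto
        then show ?thesis using m by (simp add: of_nat_diff)
      qed
      finally have "of_nat m + (\<Sum>j\<in>{1..<m}. f ^ j * (\<Sum>i<m. (x ^ j) ^ i)) \<in> M" .
      moreover have "(\<Sum>j\<in>{1..<m}. f ^ j * (\<Sum>i<m. (x ^ j) ^ i)) \<in> M"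
        by (intro Msum Mmult geo) auto
      ultimately show False using mM Mdiff by fastforce
    qed
    then obtain i where i: "i < m" "f * x ^ i - 1 \<in> M" by blast
    have 1: "f - x ^ (m - i) \<in> M"
    proof -
      have e: "x ^ i * x ^ (m - i) = x ^ m" using i by (simp flip: power_add)
      have "x ^ (m - i) * (f * x ^ i - 1) - f * (x ^ m - 1) = f - x ^ (m - i)"
        by (simp add: algebra_simps flip: e)
      then show ?thesis using Mdiff[OF Mmult[OF i(2)] Mmult[OF xm]] by metis
    qed
    \<comment> \<open>For \<open>i = 0\<close> the exponent \<open>m - i\<close> would lead to the
      index \<open>Suc m = p ^ k\<close>, which is out of range; \<open>x ^ 0\<close> replaces
      \<open>x ^ m\<close>.\<close>
    show ?thesis
    proof (cases "i = 0")
      case True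
      have "f - x ^ 0 \<in> M" using i True by simp
      then show ?thesis using m by (intro exI[of _ 1]) (simp add: rep_def)
    next
      case False
      then show ?thesis using 1 i m by (intro exI[of _ "Suc (m - i)"]) (simp add: rep_def)
    qed
  qed
  have xunit: "x ^ i \<notin> M" if "i \<le> m" for i
  proof
    assume "x ^ i \<in> M"
    from Mmult[OF this, of "x ^ (m - i)"] have "x ^ m \<in> M" using that by (simp flip: power_add)
    from Mdiff[OF this xm] show False using M(3) by simp
  qed
  have inj_less: False if "i < j" "j < p ^ k" "rep j - rep i \<in> M" for i j
  proof (cases i)
    case 0
    with that m obtain j' where "j = Suc j'" "j' \<le> m" by (cases j) auto
    then show False using that xunit[of j'] 0 by (simp add: rep_def)
  next
    case (Suc i')
    with that obtain j' where j': "j = Suc j'" by (cases j) auto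
    have "x ^ j' = x ^ i' * x ^ (j' - i')" using that Suc j' by (simp flip: power_add)
    then have "x ^ i' * (x ^ (j' - i') - 1) = x ^ j' - x ^ i'" by (simp add: algebra_simps)
    also have "\<dots> \<in> M" using that Suc j' by (simp add: rep_def)
    finally have "x ^ i' * (x ^ (j' - i') - 1) \<in> M" .
    then have "x ^ (j' - i') - 1 \<in> M" using Mprime xunit[of i'] that Suc j' m by auto
    then show False using ord[of "j' - i'"] that Suc j' m by auto
  qed
  have inj: "i = j" if "i < p ^ k" "j < p ^ k" "rep i - rep j \<in> M" for i j
  proof (rule ccontr)
    assume "i \<noteq> j"
    moreover have "rep j - rep i \<in> M" using Mneg[OF that(3)] by simp
    ultimately show False using inj_less that by (metis nat_neq_iff)
  qed
  show thesis using that[OF M(1,3) pM _ cover inj] inv by blast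
qed

text \<open>A maximal additive subgroup above \<open>M\<close> avoiding 1 has a quotient of order
  \<open>p\<close> generated by 1, and \<open>\<psi>\<close> is the exponential on this quotient.
  The field trace would not serve: its value at 1 is the degree over the prime field, which may be
  divisible by \<open>p\<close>.\<close>

lemma additive_character_mod_ideal:
  fixes M :: "'r::comm_ring_1 set"
  assumes p: "prime p" and M: "submodule_over UNIV M" "1 \<notin> M" "of_nat p \<in> M"
  obtains \<psi> :: "'r \<Rightarrow> complex" where
    "\<And>a b. \<psi> (a + b) = \<psi> a * \<psi> b" "\<And>a. cnj (\<psi> a) = \<psi> (- a)"
    "\<And>a. a \<in> M \<Longrightarrow> \<psi> a = 1" "\<psi> 1 \<noteq> 1"
proof -
  let ?Z = "range of_int :: 'r set"
  have sub: "submodule_over ?Z M" using M(1) by (auto simp: submodule_over_def)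
  have "(0::'r) \<in> ?Z" "(1::'r) \<in> ?Z"
    by (metis of_int_0 rangeI, metis of_int_1 rangeI)
  moreover have "a + b \<in> ?Z" "a * b \<in> ?Z" if "a \<in> ?Z" "b \<in> ?Z" for a b :: 'r
    using that by (auto simp flip: of_int_add of_int_mult)
  ultimately obtain H where H: "submodule_over ?Z H" "M \<subseteq> H" "1 \<notin> H"
    and max: "\<And>g. g \<notin> H \<Longrightarrow> \<exists>a\<in>?Z. 1 - a * g \<in> H"
    using maximal_submodule_avoiding_one[of ?Z M] sub M(2) by metis
  have H0: "0 \<in> H" and Hadd: "\<And>a b. a \<in> H \<Longrightarrow> b \<in> H \<Longrightarrow> a + b \<in> H"
    and Hmult: "\<And>n b. b \<in> H \<Longrightarrow> of_int n * b \<in> H"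
    using H(1) by (auto simp: submodule_over_def)
  have Hneg: "- a \<in> H" if "a \<in> H" for a using Hmult[OF that, of "-1"] by simp
  have Hdiff: "a - b \<in> H" if "a \<in> H" "b \<in> H" for a b using Hadd[OF that(1) Hneg[OF that(2)]] by simp
  have pH: "of_int (int p) * a \<in> H" for a
    using M(1,3) H(2) unfolding submodule_over_def by (metis mult.commute of_int_of_nat_eq subsetD UNIV_I)
  have int_H: "of_int n \<in> H \<longleftrightarrow> int p dvd n" for n
  proof
    assume "int p dvd n"
    then show "of_int n \<in> H" using pH by (auto elim!: dvdE)
  next
    assume n: "of_int n \<in> H"
    show "int p dvd n"
    proof (rule ccontr)
      assume "\<not> int p dvd n"
      then have "coprime n (int p)" using p by (metis coprime_commute prime_imp_coprime prime_nat_int_transfer)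
      then obtain a b where "a * n + b * int p = 1" by (metis bezout_int coprime_iff_gcd_eq_1)
      then have "1 = of_int a * of_int n + of_int (int p) * (of_int b :: 'r)"
        by (metis of_int_1 of_int_add of_int_mult mult.commute)
      then show False using Hadd[OF Hmult[OF n] pH] H(3) by metis
    qed
  qed
  \<comment> \<open>For \<open>a\<close> outside \<open>H\<close>, maximality gives \<open>n\<close>
    with \<open>n * a\<close> congruent to 1 modulo \<open>H\<close>. Such an \<open>n\<close> is
    invertible modulo \<open>p\<close>, so \<open>a\<close> is congruent to an integer.\<close>
  have ex: "\<exists>n. a - of_int n \<in> H" for a
  proof (cases "a \<in> H")
    case True
    then show ?thesis by (intro exI[of _ 0]) simp
  next
    case False
    then obtain n where n: "1 - of_int n * a \<in> H" using max by blast
    have "\<not> int p dvd n"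
    proof
      assume "int p dvd n"
      then obtain c where "n = int p * c" by (elim dvdE)
      then have "of_int n * a \<in> H" using pH[of "of_int c * a"] by (simp add: mult.assoc)
      from Hadd[OF n this] show False using H(3) by simp
    qed
    then have "coprime n (int p)" using p by (metis coprime_commute prime_imp_coprime prime_nat_int_transfer)
    then obtain c d where "c * n + d * int p = 1" by (metis bezout_int coprime_iff_gcd_eq_1)
    then have "1 = of_int c * of_int n + of_int (int p) * (of_int d :: 'r)"
      by (metis of_int_1 of_int_add of_int_mult mult.commute)
    then have "a = of_int c * of_int n * a + of_int (int p) * (of_int d * a)"
      by (metis distrib_right mult.assoc mult_1)
    then have "a - of_int c = of_int (int p) * (of_int d * a) - of_int c * (1 - of_int n * a)"
      by (simp add: algebra_simps)
    also have "\<dots> \<in> H" by (rule Hdiff[OF pH Hmult[OF n]])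
    finally show ?thesis by blast
  qed
  define \<nu> where "\<nu> a = (SOME n. a - of_int n \<in> H)" for a
  have nu: "a - of_int (\<nu> a) \<in> H" for a unfolding \<nu>_def using ex by (rule someI_ex)
  define \<psi> where "\<psi> a = cis (2 * pi * of_int (\<nu> a) / of_nat p)" for a
  have p0: "p > 0" using p prime_gt_0_nat by blast
  \<comment> \<open>The integer attached to \<open>a\<close> is determined only modulo
    \<open>p\<close>, but that is the period of the exponential; any admissible integer may be
    used.\<close>
  have psi: "\<psi> a = cis (2 * pi * of_int n / of_nat p)" if "a - of_int n \<in> H" for a n
  proof -
    have "of_int (\<nu> a - n) = (a - of_int n) - (a - of_int (\<nu> a))" by simp
    then have "int p dvd \<nu> a - n" using Hdiff[OF that nu[of a]] int_H by metis
    then obtain c where "\<nu> a = n + int p * c" by (metis add.commute diff_add_cancel dvdE)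
    then have "2 * pi * of_int (\<nu> a) / of_nat p = 2 * pi * of_int n / of_nat p + 2 * pi * of_int c"
      using p0 by (simp add: field_simps)
    then show ?thesis by (simp add: \<psi>_def flip: cis_mult)
  qed
  show thesis
  proof
    fix a b
    have "(a + b) - of_int (\<nu> a + \<nu> b) \<in> H" using Hadd[OF nu[of a] nu[of b]] by (simp add: algebra_simps)
    from psi[OF this] show "\<psi> (a + b) = \<psi> a * \<psi> b"
      by (simp add: \<psi>_def cis_mult ring_distribs add_divide_distrib)
  next
    fix a
    have "- a - of_int (- \<nu> a) \<in> H" using Hneg[OF nu[of a]] by simp
    from psi[OF this] show "cnj (\<psi> a) = \<psi> (- a)" by (simp add: \<psi>_def cis_cnj)
  next
    fix a assume "a \<in> M"
    then have "a - of_int 0 \<in> H" using H(2) by auto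
    from psi[OF this] show "\<psi> a = 1" by simp
  next
    have "1 - of_int 1 \<in> H" using H0 by simp
    from psi[OF this] have e: "\<psi> 1 = cis (2 * pi / of_nat p)" by simp
    have "p \<ge> 2" using p prime_ge_2_nat by blast
    have "inj_on (\<lambda>k. cis (2 * pi * real k / real p)) {..<p}"
      using bij_betw_imp_inj_on[OF bij_betw_roots_unity] p0 by blast
    then show "\<psi> 1 \<noteq> 1" using inj_onD[of _ _ 1 0] \<open>p \<ge> 2\<close> e by fastforce
  qed
qed

section \<open>Traces, Kronecker products and spans of matrices\<close>

lemma mat_adjoint_carrier [simp, intro]:
  "A \<in> carrier_mat n m \<Longrightarrow> mat_adjoint A \<in> carrier_mat m n"
  by (auto simp: mat_adjoint_def)

lemma mat_adjoint_dim [simp]: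
  "dim_row (mat_adjoint A) = dim_col A" "dim_col (mat_adjoint A) = dim_row A"
  by (auto simp: mat_adjoint_def)

lemma mat_adjoint_index [simp]:
  fixes A :: "complex mat"
  assumes "i < dim_col A" "j < dim_row A"
  shows "mat_adjoint A $$ (i, j) = cnj (A $$ (j, i))"
  using assms by (simp add: mat_adjoint_def mat_of_rows_def)

lemma mat_adjoint_add:
  fixes A B :: "complex mat"
  assumes "A \<in> carrier_mat n m" "B \<in> carrier_mat n m"
  shows "mat_adjoint (A + B) = mat_adjoint A + mat_adjoint B"
  by (rule eq_matI) (use assms in auto)

lemma mat_adjoint_smult:
  fixes A :: "complex mat"
  shows "mat_adjoint (c \<cdot>\<^sub>m A) = cnj c \<cdot>\<^sub>m mat_adjoint A"
  by (rule eq_matI) auto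

lemma mat_trace_add:
  assumes "A \<in> carrier_mat n n" "B \<in> carrier_mat n n"
  shows "mat_trace (A + B) = mat_trace A + mat_trace B"
  using assms by (simp add: mat_trace_def sum.distrib)

lemma mat_trace_smult:
  assumes "A \<in> carrier_mat n n"
  shows "mat_trace (c \<cdot>\<^sub>m A) = c * mat_trace A"
  using assms by (simp add: mat_trace_def sum_distrib_left)

lemma mat_trace_zero [simp]: "mat_trace (0\<^sub>m n n) = 0"
  by (simp add: mat_trace_def)

lemma mat_trace_one [simp]: "mat_trace (1\<^sub>m n) = of_nat n"
  by (simp add: mat_trace_def)

lemma mat_trace_adjoint:
  assumes "A \<in> carrier_mat n n"
  shows "mat_trace (mat_adjoint A) = cnj (mat_trace A)"
  using assms by (simp add: mat_trace_def)

lemma mat_mult_index_sum: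
  assumes "A \<in> carrier_mat n l" "B \<in> carrier_mat l m" "i < n" "j < m"
  shows "(A * B) $$ (i, j) = (\<Sum>k<l. A $$ (i, k) * B $$ (k, j))"
  using assms by (simp add: scalar_prod_def lessThan_atLeast0)

lemma mat_trace_mult_commute:
  assumes "A \<in> carrier_mat n m" "B \<in> carrier_mat m n"
  shows "mat_trace (A * B) = mat_trace (B * A)"
proof -
  have "mat_trace (A * B) = (\<Sum>i<n. \<Sum>k<m. A $$ (i, k) * B $$ (k, i))"
    unfolding mat_trace_def using assms by (intro sum.cong) (auto simp: mat_mult_index_sum[OF assms] simp del: index_mult_mat(1))
  also have "\<dots> = (\<Sum>k<m. \<Sum>i<n. B $$ (k, i) * A $$ (i, k))"
    by (subst sum.swap) (simp add: mult.commute)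
  also have "\<dots> = mat_trace (B * A)"
    unfolding mat_trace_def using assms by (intro sum.cong) (auto simp: mat_mult_index_sum[OF assms(2,1)] simp del: index_mult_mat(1))
  finally show ?thesis .
qed

section \<open>Kronecker products\<close>

definition kron :: "'a::semiring_1 mat \<Rightarrow> 'a mat \<Rightarrow> 'a mat" where
  "kron A B = mat (dim_row A * dim_row B) (dim_col A * dim_col B)
     (\<lambda>(i, j). A $$ (i div dim_row B, j div dim_col B) * B $$ (i mod dim_row B, j mod dim_col B))"

lemma kron_carrier [simp, intro]:
  "A \<in> carrier_mat m m' \<Longrightarrow> B \<in> carrier_mat q q' \<Longrightarrow> kron A B \<in> carrier_mat (m * q) (m' * q')"
  by (auto simp: kron_def)

lemma div_mod_less_mult:
  fixes i m q :: nat
  assumes "i < m * q"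
  shows "i div q < m" "i mod q < q"
  using assms by (auto simp: less_mult_imp_div_less intro!: mod_less_divisor Nat.gr0I)

text \<open>The pair \<open>(a, b)\<close> is coded as \<open>a * q + b\<close>. This turns sums
  over the index of a Kronecker product into double sums.\<close>

lemma sum_lessThan_mult_div_mod:
  fixes m q :: nat
  shows "(\<Sum>k<m * q. f (k div q) (k mod q)) = (\<Sum>a<m. \<Sum>b<q. f a b)"
proof -
  have "a * q + b < m * q" if "a < m" "b < q" for a b
  proof -
    have "a * q + b < Suc a * q" using that by simp
    also have "\<dots> \<le> m * q" using that by (intro mult_right_mono) auto
    finally show ?thesis .
  qed
  then have "(\<Sum>k<m * q. f (k div q) (k mod q)) = (\<Sum>(a, b)\<in>{..<m} \<times> {..<q}. f a b)"
    by (intro sum.reindex_bij_witness[of _ "\<lambda>(a, b). a * q + b" "\<lambda>k. (k div q, k mod q)"])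
      (auto simp: div_mod_less_mult)
  then show ?thesis by (simp add: sum.cartesian_product)
qed

lemma kron_mult:
  fixes A B C D :: "'a::comm_semiring_1 mat"
  assumes "A \<in> carrier_mat m m" "B \<in> carrier_mat q q" "C \<in> carrier_mat m m" "D \<in> carrier_mat q q"
  shows "kron A B * kron C D = kron (A * C) (B * D)"
proof (rule eq_matI)
  fix i j assume "i < dim_row (kron (A * C) (B * D))" "j < dim_col (kron (A * C) (B * D))"
  then have ij: "i < m * q" "j < m * q" using assms by (auto simp: kron_def)
  note l = div_mod_less_mult[OF ij(1)] div_mod_less_mult[OF ij(2)]
  have "(kron A B * kron C D) $$ (i, j) = (\<Sum>k<m * q. kron A B $$ (i, k) * kron C D $$ (k, j))"
    using assms ij by (simp add: kron_def scalar_prod_def lessThan_atLeast0)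
  also have "\<dots> = (\<Sum>k<m * q. (A $$ (i div q, k div q) * C $$ (k div q, j div q)) *
      (B $$ (i mod q, k mod q) * D $$ (k mod q, j mod q)))"
    using assms ij by (intro sum.cong) (auto simp: kron_def mult_ac)
  also have "\<dots> = (A * C) $$ (i div q, j div q) * (B * D) $$ (i mod q, j mod q)"
    unfolding sum_lessThan_mult_div_mod[where f = "\<lambda>a b. (A $$ (i div q, a) * C $$ (a, j div q)) *
        (B $$ (i mod q, b) * D $$ (b, j mod q))"]
    using assms l by (simp add: scalar_prod_def lessThan_atLeast0[symmetric] sum_product)
  also have "\<dots> = kron (A * C) (B * D) $$ (i, j)" using assms ij by (simp add: kron_def)
  finally show "(kron A B * kron C D) $$ (i, j) = kron (A * C) (B * D) $$ (i, j)" .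
qed (use assms in \<open>auto simp: kron_def\<close>)

lemma kron_one: "kron (1\<^sub>m m) (1\<^sub>m q) = (1\<^sub>m (m * q) :: 'a::semiring_1 mat)"
proof (rule eq_matI)
  fix i j assume "i < dim_row (1\<^sub>m (m * q) :: 'a mat)" "j < dim_col (1\<^sub>m (m * q) :: 'a mat)"
  then have ij: "i < m * q" "j < m * q" by auto
  have "i = j \<longleftrightarrow> i div q = j div q \<and> i mod q = j mod q" by (metis div_mod_decomp)
  then show "kron (1\<^sub>m m) (1\<^sub>m q) $$ (i, j) = (1\<^sub>m (m * q) :: 'a mat) $$ (i, j)"
    using div_mod_less_mult[OF ij(1)] div_mod_less_mult[OF ij(2)] ij by (auto simp: kron_def)
qed (auto simp: kron_def)

lemma kron_smult:
  fixes A B :: "'a::comm_semiring_1 mat"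
  assumes "A \<in> carrier_mat m m" "B \<in> carrier_mat q q"
  shows "kron (a \<cdot>\<^sub>m A) (b \<cdot>\<^sub>m B) = (a * b) \<cdot>\<^sub>m kron A B"
  by (rule eq_matI) (use assms in \<open>auto simp: kron_def div_mod_less_mult mult_ac\<close>)

lemma mat_adjoint_kron:
  fixes A B :: "complex mat"
  assumes "A \<in> carrier_mat m m" "B \<in> carrier_mat q q"
  shows "mat_adjoint (kron A B) = kron (mat_adjoint A) (mat_adjoint B)"
proof (rule eq_matI)
  fix i j assume "i < dim_row (kron (mat_adjoint A) (mat_adjoint B))"
    "j < dim_col (kron (mat_adjoint A) (mat_adjoint B))"
  then have ij: "i < m * q" "j < m * q" using assms by (auto simp: kron_def)
  then show "mat_adjoint (kron A B) $$ (i, j) = kron (mat_adjoint A) (mat_adjoint B) $$ (i, j)"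
    using assms div_mod_less_mult[OF ij(1)] div_mod_less_mult[OF ij(2)] by (simp add: kron_def)
qed (use assms in \<open>auto simp: kron_def\<close>)

lemma mat_trace_kron:
  assumes "A \<in> carrier_mat m m" "B \<in> carrier_mat q q"
  shows "mat_trace (kron A B) = mat_trace A * mat_trace B"
proof -
  have "mat_trace (kron A B) = (\<Sum>k<m * q. A $$ (k div q, k div q) * B $$ (k mod q, k mod q))"
    using assms unfolding mat_trace_def by (intro sum.cong) (auto simp: kron_def)
  also have "\<dots> = mat_trace A * mat_trace B"
    unfolding sum_lessThan_mult_div_mod[where f = "\<lambda>a b. A $$ (a, a) * B $$ (b, b)"]
    using assms by (simp add: mat_trace_def sum_product)
  finally show ?thesis .
qed

section \<open>Linear spans and bilinear extension\<close>

text \<open>The span is an inductive set so that statements linear in a matrix can be checked on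
  generators by rule induction.\<close>

inductive_set mat_span :: "nat \<Rightarrow> complex mat set \<Rightarrow> complex mat set" for m G where
  zero: "0\<^sub>m m m \<in> mat_span m G"
| gen: "A \<in> G \<Longrightarrow> A \<in> mat_span m G"
| add: "A \<in> mat_span m G \<Longrightarrow> B \<in> mat_span m G \<Longrightarrow> A + B \<in> mat_span m G"
| smult: "A \<in> mat_span m G \<Longrightarrow> c \<cdot>\<^sub>m A \<in> mat_span m G"

lemma mat_span_carrier:
  assumes "A \<in> mat_span m G" "G \<subseteq> carrier_mat m m"
  shows "A \<in> carrier_mat m m"
  using assms by induction auto

lemma mat_span_sum:
  assumes "finite I" "\<And>i. i \<in> I \<Longrightarrow> B i \<in> mat_span m G" "G \<subseteq> carrier_mat m m"
  shows "mat m m (\<lambda>ij. \<Sum>i\<in>I. f i * B i $$ ij) \<in> mat_span m G"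
  using assms(1,2)
proof (induction I rule: finite_induct)
  case empty
  have "mat m m (\<lambda>ij. \<Sum>i\<in>{}. f i * B i $$ ij) = 0\<^sub>m m m" by auto
  then show ?case using mat_span.zero by simp
next
  case (insert k I)
  have "B k \<in> carrier_mat m m" using mat_span_carrier insert(4) assms(3) by blast
  then have "mat m m (\<lambda>ij. \<Sum>i\<in>insert k I. f i * B i $$ ij) =
      f k \<cdot>\<^sub>m B k + mat m m (\<lambda>ij. \<Sum>i\<in>I. f i * B i $$ ij)"
    using insert(1,2) by (intro eq_matI) auto
  then show ?case using insert by (simp add: mat_span.add mat_span.smult)
qed

text \<open>Bilinearity: the left factor is first a generator while the right one runs through the
  span, and then the left factor is extended.\<close>

lemma mat_span_mult:
  assumes G: "G \<subseteq> carrier_mat m m" "\<And>g h. g \<in> G \<Longrightarrow> h \<in> G \<Longrightarrow> g * h \<in> mat_span m G"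
    and "A \<in> mat_span m G" "B \<in> mat_span m G"
  shows "A * B \<in> mat_span m G"
proof -
  have C: "X \<in> carrier_mat m m" if "X \<in> mat_span m G" for X using mat_span_carrier[OF that G(1)] .
  have gen: "g * B \<in> mat_span m G" if "g \<in> G" for g
    using assms(4)
  proof induction
    case zero
    have "g \<in> carrier_mat m m" using that G by auto
    then show ?case by (simp add: right_mult_zero_mat mat_span.zero)
  next
    case (gen A)
    then show ?case using G that by blast
  next
    case (add A B)
    have "g * (A + B) = g * A + g * B" using that G add C by (intro mult_add_distrib_mat[of _ m m]) auto
    then show ?case using add by (simp add: mat_span.add)
  next
    case (smult A c)
    have "g * (c \<cdot>\<^sub>m A) = c \<cdot>\<^sub>m (g * A)" using that G smult C by (intro mult_smult_distrib[of _ m m]) auto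
    then show ?case using smult by (simp add: mat_span.smult)
  qed
  from assms(3) show ?thesis
  proof induction
    case zero
    then show ?case using C[OF assms(4)] by (simp add: left_mult_zero_mat mat_span.zero)
  next
    case (gen A)
    then show ?case using \<open>\<And>g. g \<in> G \<Longrightarrow> g * B \<in> mat_span m G\<close> by blast
  next
    case (add A A')
    have "(A + A') * B = A * B + A' * B"
      using add C assms(4) by (intro add_mult_distrib_mat[of _ m m]) auto
    then show ?case using add by (simp add: mat_span.add)
  next
    case (smult A c)
    have "(c \<cdot>\<^sub>m A) * B = c \<cdot>\<^sub>m (A * B)" using smult C assms(4) by (intro mult_smult_assoc_mat[of _ m m]) auto
    then show ?case using smult by (simp add: mat_span.smult)
  qed
qed

lemma mat_span_adjoint:
  assumes G: "G \<subseteq> carrier_mat m m" "\<And>g. g \<in> G \<Longrightarrow> mat_adjoint g \<in> mat_span m G"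
    and "A \<in> mat_span m G"
  shows "mat_adjoint A \<in> mat_span m G"
  using assms(3)
proof induction
  case zero
  have "mat_adjoint (0\<^sub>m m m :: complex mat) = 0\<^sub>m m m" by (rule eq_matI) auto
  then show ?case by (simp add: mat_span.zero)
next
  case (add A B)
  then show ?case using mat_adjoint_add[of A m m B] mat_span_carrier[OF _ G(1)] by (simp add: mat_span.add)
next
  case (smult A c)
  then show ?case by (simp add: mat_adjoint_smult mat_span.smult)
qed (use G in blast)

text \<open>Both sides are bilinear in \<open>A\<close> and \<open>B\<close>. This identity is the
  working form of quasi-orthogonality; for matrices of trace zero it says that the product has trace
  zero, without computing complements of the scalars.\<close>

lemma mat_trace_mult_factors_span:
  assumes G: "G \<subseteq> carrier_mat m m" "H \<subseteq> carrier_mat m m"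
    and gens: "\<And>g h. g \<in> G \<Longrightarrow> h \<in> H \<Longrightarrow> of_nat m * mat_trace (g * h) = mat_trace g * mat_trace h"
    and "A \<in> mat_span m G" "B \<in> mat_span m H"
  shows "of_nat m * mat_trace (A * B) = mat_trace A * mat_trace B"
proof -
  have C: "X \<in> carrier_mat m m" if "X \<in> mat_span m G" for X using mat_span_carrier[OF that G(1)] .
  have D: "X \<in> carrier_mat m m" if "X \<in> mat_span m H" for X using mat_span_carrier[OF that G(2)] .
  have gen: "of_nat m * mat_trace (g * B) = mat_trace g * mat_trace B" if "g \<in> G" for g
    using assms(5)
  proof induction
    case zero
    have "g \<in> carrier_mat m m" using that G by auto
    then show ?case by (simp add: right_mult_zero_mat)
  next
    case (gen A)
    then show ?case using gens that by blast
  next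
    case (add A B)
    have g: "g \<in> carrier_mat m m" using that G by auto
    have "g * (A + B) = g * A + g * B" using g add D by (intro mult_add_distrib_mat[of _ m m]) auto
    moreover have "mat_trace (g * A + g * B) = mat_trace (g * A) + mat_trace (g * B)"
      using g D add by (intro mat_trace_add[of _ m] mult_carrier_mat[of _ m m]) auto
    ultimately show ?case using add D mat_trace_add[of A m B] by (simp add: algebra_simps)
  next
    case (smult A c)
    have g: "g \<in> carrier_mat m m" using that G by auto
    have "g * (c \<cdot>\<^sub>m A) = c \<cdot>\<^sub>m (g * A)" using g smult D by (intro mult_smult_distrib[of _ m m]) auto
    moreover have "mat_trace (c \<cdot>\<^sub>m (g * A)) = c * mat_trace (g * A)"
      using g D smult by (intro mat_trace_smult[of _ m] mult_carrier_mat[of _ m m]) auto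
    ultimately show ?case using smult D mat_trace_smult[of A m c] by simp
  qed
  from assms(4) show ?thesis
  proof induction
    case zero
    then show ?case using D[OF assms(5)] by (simp add: left_mult_zero_mat)
  next
    case (gen A)
    then show ?case using \<open>\<And>g. g \<in> G \<Longrightarrow> of_nat m * mat_trace (g * B) = mat_trace g * mat_trace B\<close> by blast
  next
    case (add A A')
    have "(A + A') * B = A * B + A' * B"
      using add C D assms(5) by (intro add_mult_distrib_mat[of _ m m]) auto
    moreover have "mat_trace (A * B + A' * B) = mat_trace (A * B) + mat_trace (A' * B)"
      using C D add assms(5) by (intro mat_trace_add[of _ m] mult_carrier_mat[of _ m m]) auto
    ultimately show ?case using add C mat_trace_add[of A m A'] by (simp add: algebra_simps)
  next
    case (smult A c)
    have "(c \<cdot>\<^sub>m A) * B = c \<cdot>\<^sub>m (A * B)" using smult C D assms(5) by (intro mult_smult_assoc_mat[of _ m m]) auto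
    moreover have "mat_trace (c \<cdot>\<^sub>m (A * B)) = c * mat_trace (A * B)"
      using C D smult assms(5) by (intro mat_trace_smult[of _ m] mult_carrier_mat[of _ m m]) auto
    ultimately show ?case using smult C mat_trace_smult[of A m c] by simp
  qed
qed

section \<open>Weyl systems\<close>

text \<open>
  No type depends on \<open>p\<close> and \<open>k\<close>, so the field with \<open>q\<close> elements is a quotient of a fixed ring,
  and its elements are handled through representatives and congruences modulo \<open>M\<close>.
\<close>

locale residue_field =
  fixes M :: "'r::comm_ring_1 set" and q :: nat and rep :: "nat \<Rightarrow> 'r" and \<psi> :: "'r \<Rightarrow> complex"
  assumes ideal: "submodule_over UNIV M"
    and one_notin: "1 \<notin> M" and two_notin: "2 \<notin> M"
    and inverse_ex: "f \<notin> M \<Longrightarrow> \<exists>g. 1 - g * f \<in> M"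
    and rep_ex: "\<exists>i<q. f - rep i \<in> M"
    and rep_inj: "i < q \<Longrightarrow> j < q \<Longrightarrow> rep i - rep j \<in> M \<Longrightarrow> i = j"
    and char_add: "\<psi> (a + b) = \<psi> a * \<psi> b"
    and char_cnj: "cnj (\<psi> a) = \<psi> (- a)"
    and char_ideal: "a \<in> M \<Longrightarrow> \<psi> a = 1"
    and char_one: "\<psi> 1 \<noteq> 1"
begin

section \<open>Arithmetic modulo the ideal and character sums\<close>

lemma M_zero [simp]: "0 \<in> M"
  and M_add: "a \<in> M \<Longrightarrow> b \<in> M \<Longrightarrow> a + b \<in> M"
  and M_mult: "b \<in> M \<Longrightarrow> a * b \<in> M"
  using ideal by (auto simp: submodule_over_def)

lemma M_mult_right: "b \<in> M \<Longrightarrow> b * a \<in> M"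
  by (subst mult.commute) (rule M_mult)

lemma M_neg: "- a \<in> M \<longleftrightarrow> a \<in> M"
  using M_mult[of a "-1"] M_mult[of "- a" "-1"] by auto

lemma M_diff: "a \<in> M \<Longrightarrow> b \<in> M \<Longrightarrow> a - b \<in> M"
  using M_add[of a "- b"] by (simp add: M_neg)

lemma M_prime: assumes ab: "a * b \<in> M" "a \<notin> M" shows "b \<in> M"
proof -
  obtain c where "1 - c * a \<in> M" using inverse_ex[OF ab(2)] by blast
  from M_mult[OF this, of b] have "b - c * (a * b) \<in> M" by (simp add: algebra_simps)
  from M_add[OF this M_mult[OF ab(1), of c]] show ?thesis by simp
qed

lemma M_cong_diff: "a - b \<in> M \<Longrightarrow> a \<in> M \<longleftrightarrow> b \<in> M"
  using M_diff[of a "a - b"] M_add[of b "a - b"] by auto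

lemma char_zero [simp]: "\<psi> 0 = 1"
  by (rule char_ideal) simp

lemma char_cong: "a - b \<in> M \<Longrightarrow> \<psi> a = \<psi> b"
  using char_add[of "a - b" b] by (simp add: char_ideal)

definition idx :: "'r \<Rightarrow> nat" where "idx a = (SOME i. i < q \<and> a - rep i \<in> M)"

lemma idx: "idx a < q" "a - rep (idx a) \<in> M"
  using someI_ex[OF rep_ex[of a, unfolded Bex_def]] unfolding idx_def by auto

lemma idx_eqI: "i < q \<Longrightarrow> a - rep i \<in> M \<Longrightarrow> idx a = i"
  using M_diff[of "a - rep i" "a - rep (idx a)"] idx[of a] by (auto intro!: rep_inj)

lemma idx_iff: "i < q \<Longrightarrow> idx a = i \<longleftrightarrow> rep i - a \<in> M"
  using idx_eqI[of i a] idx(2)[of a] M_neg[of "rep i - a"] M_neg[of "a - rep i"] by auto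

lemma q_pos: "q > 0" using idx(1)[of 0] by simp

text \<open>With \<open>b\<close> inverse to \<open>y\<close>, translation by \<open>b\<close>
  permutes the residue classes and multiplies the sum by \<open>\<psi> 1\<close>, which differs from
  1.\<close>

lemma char_sum:
  assumes "y \<notin> M"
  shows "(\<Sum>j<q. \<psi> (y * rep j)) = 0"
proof -
  obtain b where b: "1 - b * y \<in> M" using inverse_ex[OF assms] by blast
  define s where "s j = idx (rep j + b)" for j
  have inj: "inj_on s {..<q}"
  proof (rule inj_onI)
    fix i j assume ij: "i \<in> {..<q}" "j \<in> {..<q}" "s i = s j"
    have "rep i + b - (rep j + b) \<in> M"
      using M_diff[OF idx(2)[of "rep i + b"] idx(2)[of "rep j + b"]] ij(3) by (simp add: s_def)
    then show "i = j" using rep_inj ij by simp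
  qed
  have bij: "bij_betw s {..<q} {..<q}"
    unfolding bij_betw_def using inj endo_inj_surj[OF finite_lessThan _ inj] idx(1) by (auto simp: s_def)
  have "(\<Sum>j<q. \<psi> (y * rep j)) = (\<Sum>j<q. \<psi> (y * rep (s j)))"
    using sum.reindex_bij_betw[OF bij, of "\<lambda>j. \<psi> (y * rep j)"] by simp
  also have "\<dots> = (\<Sum>j<q. \<psi> (b * y) * \<psi> (y * rep j))"
  proof (rule sum.cong)
    fix j
    have "b * y + y * rep j - y * rep (s j) = y * (rep j + b - rep (s j))" by (simp add: algebra_simps)
    also have "\<dots> \<in> M" unfolding s_def by (intro M_mult idx)
    finally show "\<psi> (y * rep (s j)) = \<psi> (b * y) * \<psi> (y * rep j)" using char_cong char_add by metis
  qed simp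
  also have "\<dots> = \<psi> 1 * (\<Sum>j<q. \<psi> (y * rep j))"
    using char_cong[OF b] by (simp add: sum_distrib_left)
  finally show ?thesis using char_one by simp
qed

section \<open>Projective representations of the symplectic plane\<close>

abbreviation null :: "('r \<times> 'r) set" where "null \<equiv> M \<times> M"

lemma null_iff: "u \<in> null \<longleftrightarrow> fst u \<in> M \<and> snd u \<in> M" by (auto simp: mem_Times_iff)

lemma null_neg: "- u \<in> null \<longleftrightarrow> u \<in> null" by (simp add: null_iff M_neg)

lemma null_add: "u \<in> null \<Longrightarrow> v \<in> null \<Longrightarrow> u + v \<in> null" by (simp add: null_iff M_add)

lemma null_add_iff: "u + v \<in> null \<Longrightarrow> u \<in> null \<longleftrightarrow> v \<in> null"
  using null_add[of "u + v" "- v"] null_add[of "u + v" "- u"] by (auto simp: null_neg)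

definition sympl :: "'r \<times> 'r \<Rightarrow> 'r \<times> 'r \<Rightarrow> 'r" where
  "sympl u v = snd u * fst v - fst u * snd v"

lemma sympl_null: "u \<in> null \<Longrightarrow> sympl u v \<in> M"
  by (auto simp: sympl_def null_iff intro!: M_diff M_mult_right)

text \<open>The parameter \<open>c\<close> may vanish here, so that the trivial representation is
  included. Unitarity is implicit: \<open>sympl u (- u)\<close> is 0, hence
  \<open>W u * W (- u) = W 0 = 1\<^sub>m m\<close>.\<close>

definition proj_rep :: "nat \<Rightarrow> 'r \<Rightarrow> ('r \<times> 'r \<Rightarrow> complex mat) \<Rightarrow> bool" where
  "proj_rep m c W \<longleftrightarrow> (\<forall>u. W u \<in> carrier_mat m m) \<and>
     (\<forall>u v. W u * W v = \<psi> (c * sympl u v) \<cdot>\<^sub>m W (u + v)) \<and>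
     (\<forall>u. mat_adjoint (W u) = W (- u)) \<and> (\<forall>u\<in>null. W u = 1\<^sub>m m)"

lemma proj_rep_carrier: "proj_rep m c W \<Longrightarrow> W u \<in> carrier_mat m m"
  and proj_rep_mult: "proj_rep m c W \<Longrightarrow> W u * W v = \<psi> (c * sympl u v) \<cdot>\<^sub>m W (u + v)"
  and proj_rep_adjoint: "proj_rep m c W \<Longrightarrow> mat_adjoint (W u) = W (- u)"
  and proj_rep_null: "proj_rep m c W \<Longrightarrow> u \<in> null \<Longrightarrow> W u = 1\<^sub>m m"
  unfolding proj_rep_def by blast+

text \<open>On \<open>null\<close> the operators are the identity and the phase is trivial, so
  \<open>W\<close> descends to the plane over the residue field.\<close>

lemma proj_rep_cong:
  assumes W: "proj_rep m c W" and "u - v \<in> null"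
  shows "W u = W v"
proof -
  have "W v = W (u - v) * W v"
    using proj_rep_null[OF assms] left_mult_one_mat[OF proj_rep_carrier[OF W, of v]] by simp
  also have "\<dots> = \<psi> (c * sympl (u - v) v) \<cdot>\<^sub>m W u" using proj_rep_mult[OF W, of "u - v" v] by simp
  also have "\<psi> (c * sympl (u - v) v) = 1" by (intro char_ideal M_mult sympl_null assms)
  finally show ?thesis by (auto intro!: eq_matI)
qed

definition weyl :: "nat \<Rightarrow> 'r \<Rightarrow> ('r \<times> 'r \<Rightarrow> complex mat) \<Rightarrow> bool" where
  "weyl m c W \<longleftrightarrow> proj_rep m c W \<and> c \<notin> M \<and> m > 0 \<and> (\<forall>u. u \<notin> null \<longrightarrow> mat_trace (W u) = 0)"

lemma weyl_proj_rep: "weyl m c W \<Longrightarrow> proj_rep m c W"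
  and weyl_trace: "weyl m c W \<Longrightarrow> u \<notin> null \<Longrightarrow> mat_trace (W u) = 0"
  unfolding weyl_def by blast+

lemma weyl_trace_mult:
  assumes W: "weyl m c W" and "u + v \<notin> null"
  shows "mat_trace (W u * W v) = 0"
  using weyl_trace[OF assms] mat_trace_smult[OF proj_rep_carrier[OF weyl_proj_rep[OF W]]]
  by (simp add: proj_rep_mult[OF weyl_proj_rep[OF W]])

text \<open>Phases multiply, so parameters add, and traces multiply, so it is enough that one factor
  is traceless. The disjunction in the trace condition covers both a Weyl system on the left and the
  trivial representation on the left.\<close>

lemma weyl_kron:
  assumes W: "proj_rep m c W" and V: "proj_rep n d V" and "c + d \<notin> M" "m > 0" "n > 0"
    and tr: "\<And>u. u \<notin> null \<Longrightarrow> mat_trace (W u) = 0 \<or> mat_trace (V u) = 0"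
  shows "weyl (m * n) (c + d) (\<lambda>u. kron (W u) (V u))"
  unfolding weyl_def proj_rep_def
proof (intro conjI allI impI ballI)
  note Wc = proj_rep_carrier[OF W] and Vc = proj_rep_carrier[OF V]
  fix u v
  show "kron (W u) (V u) \<in> carrier_mat (m * n) (m * n)" using Wc Vc by blast
  show "kron (W u) (V u) * kron (W v) (V v) = \<psi> ((c + d) * sympl u v) \<cdot>\<^sub>m kron (W (u + v)) (V (u + v))"
    by (simp add: kron_mult[OF Wc Vc Wc Vc] proj_rep_mult[OF W] proj_rep_mult[OF V] kron_smult[OF Wc Vc]
        distrib_right char_add)
  show "mat_adjoint (kron (W u) (V u)) = kron (W (- u)) (V (- u))"
    by (simp add: mat_adjoint_kron[OF Wc Vc] proj_rep_adjoint[OF W] proj_rep_adjoint[OF V])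
  show "kron (W u) (V u) = 1\<^sub>m (m * n)" if "u \<in> null"
    using that by (simp add: proj_rep_null[OF W] proj_rep_null[OF V] kron_one)
  show "mat_trace (kron (W u) (V u)) = 0" if "u \<notin> null"
    using tr[OF that] by (auto simp: mat_trace_kron[OF Wc Vc])
qed (use assms in auto)

lemma proj_rep_trivial: "proj_rep m 0 (\<lambda>_. 1\<^sub>m m)"
  unfolding proj_rep_def by (auto intro!: eq_matI)

text \<open>An additive map that scales the symplectic form by \<open>e\<close> scales the parameter
  by \<open>e\<close>.\<close>

lemma proj_rep_comp:
  assumes W: "proj_rep m c W" and T: "\<And>u v. T (u + v) = T u + T v" "\<And>u. u \<in> null \<Longrightarrow> T u \<in> null"
    "\<And>u v. sympl (T u) (T v) = e * sympl u v"
  shows "proj_rep m (c * e) (\<lambda>u. W (T u))"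
proof -
  have "T 0 = 0" using T(1)[of 0 0] by simp
  then have "T (- u) = - T u" for u using T(1)[of u "- u"] by (simp add: eq_neg_iff_add_eq_0 add.commute)
  then show ?thesis
    unfolding proj_rep_def using T
    by (auto simp: proj_rep_carrier[OF W] proj_rep_mult[OF W] proj_rep_adjoint[OF W] mult.assoc
        intro!: proj_rep_null[OF W])
qed

section \<open>The standard system on functions on the field\<close>

text \<open>
  The operator of \<open>(x, y)\<close> maps the basis vector \<open>e\<^sub>j\<close> to \<open>\<psi>(y (x + 2 j)) e\<^bsub>j + x\<^esub>\<close>; the phase
  \<open>\<psi>(x y)\<close> makes the cocycle alternating without halving anything.
\<close>

definition schroedinger :: "'r \<times> 'r \<Rightarrow> complex mat" where
  "schroedinger u = mat q q (\<lambda>(i, j).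
     if idx (rep j + fst u) = i then \<psi> (snd u * (fst u + 2 * rep j)) else 0)"

lemma schroedinger_carrier: "schroedinger u \<in> carrier_mat q q"
  by (simp add: schroedinger_def)

lemma proj_rep_schroedinger: "proj_rep q 1 schroedinger"
  unfolding proj_rep_def
proof (intro conjI allI ballI)
  fix u v
  show "schroedinger u * schroedinger v = \<psi> (1 * sympl u v) \<cdot>\<^sub>m schroedinger (u + v)"
  proof (rule eq_matI)
    fix i j assume "i < dim_row (\<psi> (1 * sympl u v) \<cdot>\<^sub>m schroedinger (u + v))"
      "j < dim_col (\<psi> (1 * sympl u v) \<cdot>\<^sub>m schroedinger (u + v))"
    then have ij: "i < q" "j < q" by (auto simp: schroedinger_def)
    define k where "k = idx (rep j + fst v)"
    have k: "k < q" "rep j + fst v - rep k \<in> M" using idx by (auto simp: k_def)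
    have "(schroedinger u * schroedinger v) $$ (i, j) =
        (\<Sum>l<q. schroedinger u $$ (i, l) * schroedinger v $$ (l, j))"
      by (rule mat_mult_index_sum[OF schroedinger_carrier schroedinger_carrier ij])
    \<comment> \<open>Each column of \<open>schroedinger v\<close> has a single nonzero entry, which
      for column \<open>j\<close> is in row \<open>k\<close>.\<close>
    also have "\<dots> = (\<Sum>l<q. if l = k then schroedinger u $$ (i, k) * \<psi> (snd v * (fst v + 2 * rep j)) else 0)"
      using ij by (intro sum.cong) (auto simp: schroedinger_def k_def)
    also have "\<dots> = schroedinger u $$ (i, k) * \<psi> (snd v * (fst v + 2 * rep j))"
      using k by simp
    also have "\<dots> = (\<psi> (1 * sympl u v) \<cdot>\<^sub>m schroedinger (u + v)) $$ (i, j)"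
    proof -
      have 1: "idx (rep k + fst u) = i \<longleftrightarrow> idx (rep j + fst (u + v)) = i"
      proof -
        have "rep i - (rep k + fst u) - (rep i - (rep j + fst (u + v))) = rep j + fst v - rep k"
          by (simp add: algebra_simps)
        then show ?thesis using k(2) ij M_cong_diff by (metis idx_iff)
      qed
      \<comment> \<open>Replacing \<open>rep j + fst v\<close> by its representative
        \<open>rep k\<close> changes the exponent only by an element of \<open>M\<close>.\<close>
      have 2: "\<psi> (snd u * (fst u + 2 * rep k)) * \<psi> (snd v * (fst v + 2 * rep j)) =
          \<psi> (sympl u v) * \<psi> (snd (u + v) * (fst (u + v) + 2 * rep j))"
      proof -
        have "sympl u v + snd (u + v) * (fst (u + v) + 2 * rep j) -
            (snd u * (fst u + 2 * rep k) + snd v * (fst v + 2 * rep j)) =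
            2 * snd u * (rep j + fst v - rep k)"
          by (simp add: sympl_def algebra_simps)
        also have "\<dots> \<in> M" by (rule M_mult[OF k(2)])
        finally show ?thesis using char_cong char_add by metis
      qed
      show ?thesis using ij k(1) by (auto simp: schroedinger_def 1 2[simplified])
    qed
    finally show "(schroedinger u * schroedinger v) $$ (i, j) =
        (\<psi> (1 * sympl u v) \<cdot>\<^sub>m schroedinger (u + v)) $$ (i, j)" .
  qed (auto simp: schroedinger_def)
next
  fix u
  show "mat_adjoint (schroedinger u) = schroedinger (- u)"
  proof (rule eq_matI)
    fix i j assume "i < dim_row (schroedinger (- u))" "j < dim_col (schroedinger (- u))"
    then have ij: "i < q" "j < q" by (auto simp: schroedinger_def)
    have 1: "idx (rep i + fst u) = j \<longleftrightarrow> idx (rep j - fst u) = i"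
    proof -
      have "rep i - (rep j - fst u) = - (rep j - (rep i + fst u))" by (simp add: algebra_simps)
      then show ?thesis using ij by (metis M_neg idx_iff)
    qed
    have 2: "\<psi> (- (snd u * (fst u + 2 * rep i))) = \<psi> (- (snd u * (2 * rep j - fst u)))"
      if "idx (rep i + fst u) = j"
    proof -
      have "rep j - (rep i + fst u) \<in> M" using that ij idx_iff by blast
      from M_mult[OF this, of "2 * snd u"] show ?thesis
        by (intro char_cong) (simp add: algebra_simps)
    qed
    show "mat_adjoint (schroedinger u) $$ (i, j) = schroedinger (- u) $$ (i, j)"
      using ij 2 by (auto simp: schroedinger_def 1 char_cnj)
  qed (auto simp: schroedinger_def)
next
  fix u assume u: "u \<in> null"
  show "schroedinger u = 1\<^sub>m q"
  proof (rule eq_matI)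
    fix i j assume "i < dim_row (1\<^sub>m q)" "j < dim_col (1\<^sub>m q)"
    then have ij: "i < q" "j < q" by auto
    have "idx (rep j + fst u) = j" using ij u by (intro idx_eqI) (auto simp: null_iff)
    moreover have "\<psi> (snd u * (fst u + 2 * rep j)) = 1"
      using u by (intro char_ideal M_mult_right) (auto simp: null_iff)
    ultimately show "schroedinger u $$ (i, j) = 1\<^sub>m q $$ (i, j)"
      using ij by (auto simp: schroedinger_def)
  qed (auto simp: schroedinger_def)
qed (rule schroedinger_carrier)

text \<open>A nonzero shift leaves the diagonal empty. With zero shift the operator is diagonal and
  its trace is the character sum with frequency \<open>2 * snd u\<close>, which is nonzero because 2
  is invertible.\<close>

lemma weyl_schroedinger: "weyl q 1 schroedinger"
  unfolding weyl_def
proof (intro conjI allI impI)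
  fix u assume u: "u \<notin> null"
  show "mat_trace (schroedinger u) = 0"
  proof (cases "fst u \<in> M")
    case False
    have "idx (rep j + fst u) \<noteq> j" if "j < q" for j
      using idx_iff[OF that, of "rep j + fst u"] False M_neg[of "fst u"] by simp
    then show ?thesis by (simp add: mat_trace_def schroedinger_def)
  next
    case True
    then have y: "snd u \<notin> M" using u by (simp add: null_iff)
    have "2 * snd u \<notin> M" using M_prime[OF _ two_notin] y by blast
    then have s: "(\<Sum>j<q. \<psi> (2 * snd u * rep j)) = 0" by (rule char_sum)
    have "mat_trace (schroedinger u) = (\<Sum>j<q. \<psi> (2 * snd u * rep j))"
      unfolding mat_trace_def
    proof (rule sum.cong)
      fix j assume "j \<in> {..<q}"
      then have j: "j < q" by simp
      have "idx (rep j + fst u) = j" using j True by (intro idx_eqI) auto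
      moreover have "\<psi> (snd u * (fst u + 2 * rep j)) = \<psi> (2 * snd u * rep j)"
      proof (rule char_cong)
        have "snd u * (fst u + 2 * rep j) - 2 * snd u * rep j = snd u * fst u"
          by (simp add: algebra_simps)
        then show "snd u * (fst u + 2 * rep j) - 2 * snd u * rep j \<in> M" using M_mult[OF True] by simp
      qed
      ultimately show "schroedinger u $$ (j, j) = \<psi> (2 * snd u * rep j)"
        using j by (simp add: schroedinger_def)
    qed (simp add: schroedinger_def)
    then show ?thesis using s by simp
  qed
qed (use proj_rep_schroedinger one_notin q_pos in auto)

text \<open>Fourier inversion in the second coordinate, with the shift held fixed, produces every
  matrix unit.\<close>

lemma mat_span_schroedinger: "mat_span q (range schroedinger) = carrier_mat q q"
proof
  show "mat_span q (range schroedinger) \<subseteq> carrier_mat q q"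
    using mat_span_carrier[of _ q "range schroedinger"] schroedinger_carrier by blast
  have G: "range schroedinger \<subseteq> carrier_mat q q" using schroedinger_carrier by blast
  define E where "E ab = mat q q (\<lambda>ij. if ij = ab then 1 else 0 :: complex)" for ab
  have E: "E (a, b) \<in> mat_span q (range schroedinger)" if ab: "a < q" "b < q" for a b
  proof -
    \<comment> \<open>The shift \<open>x\<close> moves basis vector \<open>b\<close> to basis vector
      \<open>a\<close>. Averaging over \<open>y\<close> with the weights \<open>?f\<close> then
      removes all columns other than \<open>b\<close>.\<close>
    define x where "x = rep a - rep b"
    let ?f = "\<lambda>y. \<psi> (- (rep y * (x + 2 * rep b))) / of_nat q"
    have "E (a, b) = mat q q (\<lambda>ij. \<Sum>y<q. ?f y * schroedinger (x, rep y) $$ ij)"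
    proof (rule eq_matI)
      fix i j assume "i < dim_row (mat q q (\<lambda>ij. \<Sum>y<q. ?f y * schroedinger (x, rep y) $$ ij))"
        "j < dim_col (mat q q (\<lambda>ij. \<Sum>y<q. ?f y * schroedinger (x, rep y) $$ ij))"
      then have ij: "i < q" "j < q" by auto
      define z where "z = 2 * (rep j - rep b)"
      have t: "\<psi> (- (rep y * (x + 2 * rep b))) * \<psi> (rep y * (x + 2 * rep j)) = \<psi> (z * rep y)" for y
        by (simp add: char_add[symmetric] z_def algebra_simps)
      have "(\<Sum>y<q. ?f y * schroedinger (x, rep y) $$ (i, j)) =
          (if idx (rep j + x) = i then (\<Sum>y<q. \<psi> (z * rep y)) / of_nat q else 0)"
        using ij by (simp add: schroedinger_def t sum_divide_distrib)
      also have "\<dots> = (if (i, j) = (a, b) then 1 else 0)"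
      proof (cases "j = b")
        case True
        then show ?thesis using ab idx_eqI[OF ab(1), of "rep a"] q_pos by (auto simp: x_def z_def)
      next
        case False
        then have "rep j - rep b \<notin> M" using rep_inj ij ab by blast
        then have "z \<notin> M" unfolding z_def using M_prime[OF _ two_notin] by blast
        from char_sum[OF this] show ?thesis using False by simp
      qed
      finally show "E (a, b) $$ (i, j) = mat q q (\<lambda>ij. \<Sum>y<q. ?f y * schroedinger (x, rep y) $$ ij) $$ (i, j)"
        using ij by (simp add: E_def)
    qed (auto simp: E_def)
    moreover have "mat q q (\<lambda>ij. \<Sum>y<q. ?f y * schroedinger (x, rep y) $$ ij) \<in> mat_span q (range schroedinger)"
      by (rule mat_span_sum[OF _ _ G]) (auto intro: mat_span.gen)
    ultimately show ?thesis by simp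
  qed
  show "carrier_mat q q \<subseteq> mat_span q (range schroedinger)"
  proof
    fix A :: "complex mat" assume A: "A \<in> carrier_mat q q"
    have "A = mat q q (\<lambda>ij. \<Sum>ab\<in>{..<q} \<times> {..<q}. A $$ ab * E ab $$ ij)"
    proof (rule eq_matI)
      fix i j assume "i < dim_row (mat q q (\<lambda>ij. \<Sum>ab\<in>{..<q} \<times> {..<q}. A $$ ab * E ab $$ ij))"
        "j < dim_col (mat q q (\<lambda>ij. \<Sum>ab\<in>{..<q} \<times> {..<q}. A $$ ab * E ab $$ ij))"
      then have ij: "i < q" "j < q" by auto
      have "(\<Sum>ab\<in>{..<q} \<times> {..<q}. A $$ ab * E ab $$ (i, j)) =
          (\<Sum>ab\<in>{..<q} \<times> {..<q}. if ab = (i, j) then A $$ (i, j) else 0)"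
        using ij by (intro sum.cong) (auto simp: E_def)
      also have "\<dots> = A $$ (i, j)" using ij by simp
      finally show "A $$ (i, j) = mat q q (\<lambda>ij. \<Sum>ab\<in>{..<q} \<times> {..<q}. A $$ ab * E ab $$ ij) $$ (i, j)"
        using ij by simp
    qed (use A in auto)
    moreover have "mat q q (\<lambda>ij. \<Sum>ab\<in>{..<q} \<times> {..<q}. A $$ ab * E ab $$ ij) \<in> mat_span q (range schroedinger)"
      by (rule mat_span_sum[OF _ _ G]) (auto intro: E)
    ultimately show "A \<in> mat_span q (range schroedinger)" by simp
  qed
qed

subsection \<open>The algebra generated by a Weyl system\<close>

text \<open>The linear map intended to send \<open>W u\<close> to \<open>V u\<close>, given by the
  Fourier coefficients of \<open>A\<close> with respect to \<open>W\<close>. The explicit formula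
  makes linearity immediate and avoids extending a map from a basis.\<close>

definition weyl_transfer :: "nat \<Rightarrow> ('r \<times> 'r \<Rightarrow> complex mat) \<Rightarrow> nat \<Rightarrow>
    ('r \<times> 'r \<Rightarrow> complex mat) \<Rightarrow> complex mat \<Rightarrow> complex mat" where
  "weyl_transfer m W n V A = mat n n (\<lambda>ij. \<Sum>(a, b)\<in>{..<q} \<times> {..<q}.
     mat_trace (W (- (rep a, rep b)) * A) / of_nat m * V (rep a, rep b) $$ ij)"

lemma weyl_transfer_carrier: "weyl_transfer m W n V A \<in> carrier_mat n n"
  by (simp add: weyl_transfer_def)

text \<open>The operators \<open>W u\<close> are orthonormal for the normalized trace, so only the
  term of the representative congruent to \<open>u\<close> survives.\<close>

lemma weyl_transfer_apply:
  assumes W: "weyl m c W" and V: "proj_rep n d V"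
  shows "weyl_transfer m W n V (W u) = V u"
proof -
  let ?I = "{..<q} \<times> {..<q}"
  let ?r = "\<lambda>(a, b). (rep a, rep b)"
  define k where "k = (idx (fst u), idx (snd u))"
  have k: "k \<in> ?I" "u - ?r k \<in> null" using idx by (auto simp: k_def null_iff)
  have tr: "mat_trace (W (- ?r i) * W u) / of_nat m = (if i = k then 1 else 0)" if "i \<in> ?I" for i
  proof (cases "i = k")
    case True
    have "W u = W (?r k)" by (rule proj_rep_cong[OF weyl_proj_rep[OF W] k(2)])
    then have "W (- ?r i) * W u = \<psi> (c * sympl (- ?r k) (?r k)) \<cdot>\<^sub>m W 0"
      using True proj_rep_mult[OF weyl_proj_rep[OF W], of "- ?r k" "?r k"] by simp
    also have "sympl (- ?r k) (?r k) = 0" by (simp add: sympl_def)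
    also have "W 0 = 1\<^sub>m m" by (rule proj_rep_null[OF weyl_proj_rep[OF W]]) (simp add: null_iff)
    finally show ?thesis using True W by (simp add: mat_trace_smult[of _ m] weyl_def)
  next
    case False
    have "idx (fst u) = fst i \<and> idx (snd u) = snd i" if "- ?r i + u \<in> null"
      using that \<open>i \<in> ?I\<close> by (auto simp: null_iff intro!: idx_eqI)
    then have "- ?r i + u \<notin> null" using False by (auto simp: k_def)
    then show ?thesis using False weyl_trace_mult[OF W] by simp
  qed
  show ?thesis
  proof (rule eq_matI)
    fix i j assume "i < dim_row (V u)" "j < dim_col (V u)"
    then have ij: "i < n" "j < n" using proj_rep_carrier[OF V, of u] by auto
    have "weyl_transfer m W n V (W u) $$ (i, j) =
        (\<Sum>l\<in>?I. mat_trace (W (- ?r l) * W u) / of_nat m * V (?r l) $$ (i, j))"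
      using ij by (simp add: weyl_transfer_def split_def)
    also have "\<dots> = (\<Sum>l\<in>?I. if l = k then V (?r k) $$ (i, j) else 0)"
      by (intro sum.cong refl) (simp only: tr, simp)
    also have "\<dots> = V (?r k) $$ (i, j)" using k(1) by simp
    also have "V (?r k) = V u" by (rule proj_rep_cong[OF V k(2), symmetric])
    finally show "weyl_transfer m W n V (W u) $$ (i, j) = V u $$ (i, j)" .
  qed (use proj_rep_carrier[OF V, of u] in \<open>auto simp: weyl_transfer_def\<close>)
qed

lemma weyl_transfer_add:
  assumes W: "proj_rep m c W" and V: "proj_rep n d V"
    and "A \<in> carrier_mat m m" "B \<in> carrier_mat m m"
  shows "weyl_transfer m W n V (A + B) = weyl_transfer m W n V A + weyl_transfer m W n V B"
proof -
  have "mat_trace (W u * (A + B)) = mat_trace (W u * A) + mat_trace (W u * B)" for u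
    using assms proj_rep_carrier[OF W, of u]
    by (simp add: mult_add_distrib_mat[of _ m m] mat_trace_add[of _ m] mult_carrier_mat[of _ m m])
  then show ?thesis
    by (intro eq_matI) (auto simp: weyl_transfer_def add_divide_distrib distrib_right sum.distrib split_def)
qed

lemma weyl_transfer_smult:
  assumes W: "proj_rep m c W" and V: "proj_rep n d V" and "A \<in> carrier_mat m m"
  shows "weyl_transfer m W n V (a \<cdot>\<^sub>m A) = a \<cdot>\<^sub>m weyl_transfer m W n V A"
proof -
  have "mat_trace (W u * (a \<cdot>\<^sub>m A)) = a * mat_trace (W u * A)" for u
    using assms proj_rep_carrier[OF W, of u]
    by (simp add: mult_smult_distrib[of _ m m] mat_trace_smult[of _ m] mult_carrier_mat[of _ m m])
  then show ?thesis
    by (intro eq_matI) (auto simp: weyl_transfer_def sum_distrib_left split_def mult.assoc)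
qed

lemma proj_rep_range: "proj_rep m c W \<Longrightarrow> range W \<subseteq> carrier_mat m m"
  using proj_rep_carrier by blast

lemma weyl_span_star_subalgebra:
  assumes W: "proj_rep m c W"
  shows "star_subalgebra m (mat_span m (range W))"
  unfolding star_subalgebra_def
proof (intro conjI ballI allI)
  note R = proj_rep_range[OF W]
  show "mat_span m (range W) \<subseteq> carrier_mat m m" using mat_span_carrier[OF _ R] by blast
  have "W 0 = 1\<^sub>m m" by (rule proj_rep_null[OF W]) (simp add: null_iff)
  then show "1\<^sub>m m \<in> mat_span m (range W)" by (metis mat_span.gen rangeI)
  fix A assume A: "A \<in> mat_span m (range W)"
  show "a \<cdot>\<^sub>m A \<in> mat_span m (range W)" for a by (rule mat_span.smult[OF A])
  show "mat_adjoint A \<in> mat_span m (range W)"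
    by (rule mat_span_adjoint[OF R _ A]) (auto simp: proj_rep_adjoint[OF W] intro: mat_span.gen)
  fix B assume B: "B \<in> mat_span m (range W)"
  show "A + B \<in> mat_span m (range W)" by (rule mat_span.add[OF A B])
  show "A * B \<in> mat_span m (range W)"
  proof (rule mat_span_mult[OF R _ A B])
    fix g h assume "g \<in> range W" "h \<in> range W"
    then obtain u v where "g = W u" "h = W v" by blast
    then show "g * h \<in> mat_span m (range W)"
      by (simp add: proj_rep_mult[OF W] mat_span.gen mat_span.smult)
  qed
qed

lemma weyl_transfer_zero: 
  assumes W: "proj_rep m c W" shows "weyl_transfer m W n V (0\<^sub>m m m) = 0\<^sub>m n n"
proof -
  have "W u * 0\<^sub>m m m = 0\<^sub>m m m" for u using proj_rep_carrier[OF W] by (rule right_mult_zero_mat)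
  then show ?thesis by (intro eq_matI) (auto simp: weyl_transfer_def)
qed

text \<open>The transfers in the two directions are inverse to each other on generators, and both
  are linear.\<close>

lemma weyl_transfer_span:
  assumes W: "weyl m c W" and V: "weyl n d V" and A: "A \<in> mat_span m (range W)"
  shows "weyl_transfer m W n V A \<in> mat_span n (range V)" "weyl_transfer n V m W (weyl_transfer m W n V A) = A"
proof -
  note Wp = weyl_proj_rep[OF W] and Vp = weyl_proj_rep[OF V]
  note C = mat_span_carrier[OF _ proj_rep_range[OF Wp]]
  have "weyl_transfer m W n V A \<in> mat_span n (range V) \<and> weyl_transfer n V m W (weyl_transfer m W n V A) = A"
    using A
  proof induction
    case zero
    then show ?case by (simp add: weyl_transfer_zero[OF Wp] weyl_transfer_zero[OF Vp] mat_span.zero)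
  next
    case (gen A)
    then show ?case by (auto simp: weyl_transfer_apply[OF W Vp] weyl_transfer_apply[OF V Wp] intro: mat_span.gen)
  next
    case (add A B)
    then show ?case
      using C by (simp add: weyl_transfer_add[OF Wp Vp] weyl_transfer_add[OF Vp Wp] weyl_transfer_carrier mat_span.add)
  next
    case (smult A a)
    then show ?case
      using C by (simp add: weyl_transfer_smult[OF Wp Vp] weyl_transfer_smult[OF Vp Wp] weyl_transfer_carrier mat_span.smult)
  qed
  then show "weyl_transfer m W n V A \<in> mat_span n (range V)" "weyl_transfer n V m W (weyl_transfer m W n V A) = A" by auto
qed

lemma weyl_transfer_adjoint:
  assumes W: "weyl m c W" and V: "proj_rep n d V" and A: "A \<in> mat_span m (range W)"
  shows "weyl_transfer m W n V (mat_adjoint A) = mat_adjoint (weyl_transfer m W n V A)"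
proof -
  note Wp = weyl_proj_rep[OF W]
  note C = mat_span_carrier[OF _ proj_rep_range[OF Wp]]
  have z: "mat_adjoint (0\<^sub>m m m :: complex mat) = 0\<^sub>m m m" for m by (rule eq_matI) auto
  show ?thesis
    using A
  proof induction
    case zero
    then show ?case by (simp add: weyl_transfer_zero[OF Wp] z)
  next
    case (gen A)
    then show ?case by (auto simp: weyl_transfer_apply[OF W V] proj_rep_adjoint[OF Wp] proj_rep_adjoint[OF V])
  next
    case (add A B)
    then show ?case
      using C mat_adjoint_add[of A m m B] mat_adjoint_carrier[of A m m] mat_adjoint_carrier[of B m m]
        mat_adjoint_add[OF weyl_transfer_carrier weyl_transfer_carrier]
      by (simp add: weyl_transfer_add[OF Wp V])
  next
    case (smult A a)
    then show ?case
      using C mat_adjoint_carrier[of A m m] by (simp add: weyl_transfer_smult[OF Wp V] mat_adjoint_smult)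
  qed
qed

text \<open>With the common parameter \<open>c\<close> both systems multiply with the same phases,
  so the claim holds on generators and extends bilinearly.\<close>

lemma weyl_transfer_mult:
  assumes W: "weyl m c W" and V: "proj_rep n c V"
    and A: "A \<in> mat_span m (range W)" and B: "B \<in> mat_span m (range W)"
  shows "weyl_transfer m W n V (A * B) = weyl_transfer m W n V A * weyl_transfer m W n V B"
proof -
  let ?t = "weyl_transfer m W n V"
  note Wp = weyl_proj_rep[OF W]
  note C = mat_span_carrier[OF _ proj_rep_range[OF Wp]]
  note tc = weyl_transfer_carrier[of m W n V]
  have gen: "?t (W u * B) = V u * ?t B" for u
    using B
  proof induction
    case zero
    show ?case
      by (simp add: weyl_transfer_zero[OF Wp] right_mult_zero_mat[OF proj_rep_carrier[OF Wp]]
          right_mult_zero_mat[OF proj_rep_carrier[OF V]])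
  next
    case (gen A)
    then obtain v where "A = W v" by blast
    then show ?case
      by (simp add: weyl_transfer_apply[OF W V] proj_rep_mult[OF Wp] proj_rep_mult[OF V]
          weyl_transfer_smult[OF Wp V proj_rep_carrier[OF Wp]])
  next
    case (add A B)
    then have AB: "A \<in> carrier_mat m m" "B \<in> carrier_mat m m" using C by auto
    note w = proj_rep_carrier[OF Wp, of u]
    have "?t (W u * (A + B)) = ?t (W u * A) + ?t (W u * B)"
      by (simp only: mult_add_distrib_mat[OF w AB] weyl_transfer_add[OF Wp V mult_carrier_mat[OF w AB(1)] mult_carrier_mat[OF w AB(2)]])
    also have "\<dots> = V u * (?t A + ?t B)"
      by (simp only: add.IH mult_add_distrib_mat[OF proj_rep_carrier[OF V] tc tc])
    finally show ?case by (simp only: weyl_transfer_add[OF Wp V AB])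
  next
    case (smult A a)
    then have A: "A \<in> carrier_mat m m" using C by auto
    note w = proj_rep_carrier[OF Wp, of u]
    have "?t (W u * (a \<cdot>\<^sub>m A)) = a \<cdot>\<^sub>m ?t (W u * A)"
      by (simp only: mult_smult_distrib[OF w A] weyl_transfer_smult[OF Wp V mult_carrier_mat[OF w A]])
    also have "\<dots> = V u * (a \<cdot>\<^sub>m ?t A)"
      by (simp only: smult.IH mult_smult_distrib[OF proj_rep_carrier[OF V] tc])
    finally show ?case by (simp only: weyl_transfer_smult[OF Wp V A])
  qed
  note b = C[OF B]
  show ?thesis
    using A
  proof induction
    case zero
    show ?case using b by (simp add: weyl_transfer_zero[OF Wp] left_mult_zero_mat[OF b] left_mult_zero_mat[OF tc])
  next
    case (gen A)
    then show ?case using \<open>\<And>u. ?t (W u * B) = V u * ?t B\<close> by (auto simp: weyl_transfer_apply[OF W V])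
  next
    case (add A A')
    then have AB: "A \<in> carrier_mat m m" "A' \<in> carrier_mat m m" using C by auto
    have "?t ((A + A') * B) = ?t (A * B) + ?t (A' * B)"
      by (simp only: add_mult_distrib_mat[OF AB b] weyl_transfer_add[OF Wp V mult_carrier_mat[OF AB(1) b] mult_carrier_mat[OF AB(2) b]])
    also have "\<dots> = (?t A + ?t A') * ?t B"
      by (simp only: add.IH add_mult_distrib_mat[OF tc tc tc])
    finally show ?case by (simp only: weyl_transfer_add[OF Wp V AB])
  next
    case (smult A a)
    then have A: "A \<in> carrier_mat m m" using C by auto
    have "?t ((a \<cdot>\<^sub>m A) * B) = a \<cdot>\<^sub>m ?t (A * B)"
      by (simp only: mult_smult_assoc_mat[OF A b] weyl_transfer_smult[OF Wp V mult_carrier_mat[OF A b]])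
    also have "\<dots> = (a \<cdot>\<^sub>m ?t A) * ?t B"
      by (simp only: smult.IH mult_smult_assoc_mat[OF tc tc])
    finally show ?case by (simp only: weyl_transfer_smult[OF Wp V A])
  qed
qed

lemma weyl_span_star_isomorphic:
  assumes W: "weyl m c W" and V: "weyl n c V"
  shows "star_isomorphic (mat_span m (range W)) (mat_span n (range V))"
proof -
  note Wp = weyl_proj_rep[OF W] and Vp = weyl_proj_rep[OF V]
  have C: "A \<in> carrier_mat m m" if "A \<in> mat_span m (range W)" for A
    using mat_span_carrier[OF that proj_rep_range[OF Wp]] .
  have "bij_betw (weyl_transfer m W n V) (mat_span m (range W)) (mat_span n (range V))"
    by (rule bij_betw_byWitness[of _ "weyl_transfer n V m W"])
      (auto simp: weyl_transfer_span[OF W V] weyl_transfer_span[OF V W])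
  then have "star_isomorphism (mat_span m (range W)) (mat_span n (range V)) (weyl_transfer m W n V)"
    unfolding star_isomorphism_def
    using weyl_transfer_add[OF Wp Vp C C] weyl_transfer_smult[OF Wp Vp C] weyl_transfer_mult[OF W Vp] weyl_transfer_adjoint[OF W Vp]
    by auto
  then show ?thesis unfolding star_isomorphic_def by blast
qed

text \<open>Scaling the first coordinate by \<open>c\<close> turns the standard system of parameter
  1 into one of parameter \<open>c\<close>. As \<open>c\<close> is invertible modulo
  \<open>M\<close>, the range and hence the span do not change.\<close>

lemma weyl_span_star_isomorphic_full:
  assumes W: "weyl m c W"
  shows "star_isomorphic (mat_span m (range W)) (carrier_mat q q)"
proof -
  have c: "c \<notin> M" using W by (simp add: weyl_def)
  define T where "T u = (c * fst u, snd u)" for u :: "'r \<times> 'r"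
  have null: "T u \<in> null \<longleftrightarrow> u \<in> null" for u
    using M_prime[of c "fst u"] c M_mult[of "fst u" c] by (auto simp: T_def null_iff)
  have "proj_rep q (1 * c) (\<lambda>u. schroedinger (T u))"
    by (rule proj_rep_comp[OF proj_rep_schroedinger])
      (auto simp: null[simplified], auto simp: T_def sympl_def null_iff M_mult algebra_simps prod_eq_iff)
  then have V: "weyl q c (\<lambda>u. schroedinger (T u))"
    unfolding weyl_def using c q_pos weyl_trace[OF weyl_schroedinger] null by simp
  have "schroedinger u \<in> range (\<lambda>u. schroedinger (T u))" for u
  proof -
    obtain b where "1 - b * c \<in> M" using inverse_ex[OF c] by blast
    from M_mult[OF this, of "fst u"] have "u - T (b * fst u, snd u) \<in> null"
      by (simp add: null_iff T_def algebra_simps)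
    from proj_rep_cong[OF proj_rep_schroedinger this] show ?thesis by blast
  qed
  then have "range (\<lambda>u. schroedinger (T u)) = range schroedinger" by blast
  then show ?thesis using weyl_span_star_isomorphic[OF W V] mat_span_schroedinger by simp
qed

section \<open>Quasi-orthogonality of Weyl systems and their tensor products\<close>

text \<open>Quasi-orthogonality of the two spans, tested on generators. The adjoint of the trace
  inner product is absent because \<open>u\<close> ranges over all pairs and the adjoint of
  \<open>W u\<close> is \<open>W (- u)\<close>.\<close>

definition orth :: "nat \<Rightarrow> ('r \<times> 'r \<Rightarrow> complex mat) \<Rightarrow> ('r \<times> 'r \<Rightarrow> complex mat) \<Rightarrow> bool" where
  "orth m W V \<longleftrightarrow> (\<forall>u v. of_nat m * mat_trace (W u * V v) = mat_trace (W u) * mat_trace (V v))"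

lemma orthD: "orth m W V \<Longrightarrow> of_nat m * mat_trace (W u * V v) = mat_trace (W u) * mat_trace (V v)"
  unfolding orth_def by blast

lemma orth_span:
  assumes W: "weyl m c W" and V: "weyl m d V" and o: "orth m W V"
    and "A \<in> mat_span m (range W)" "B \<in> mat_span m (range V)"
  shows "of_nat m * mat_trace (A * B) = mat_trace A * mat_trace B"
proof (rule mat_trace_mult_factors_span[OF _ _ _ assms(4,5)])
  fix g h assume "g \<in> range W" "h \<in> range V"
  then show "of_nat m * mat_trace (g * h) = mat_trace g * mat_trace h"
    using orthD[OF o] by blast
qed (use proj_rep_range[OF weyl_proj_rep[OF W]] proj_rep_range[OF weyl_proj_rep[OF V]] in auto)

lemma orth_quasi_orthogonal:
  assumes W: "weyl m c W" and V: "weyl m d V" and o: "orth m W V"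
  shows "quasi_orthogonal m (mat_span m (range W)) (mat_span m (range V))"
  unfolding quasi_orthogonal_def
proof (intro ballI)
  fix A B
  assume A: "A \<in> orth_compl_in (mat_span m (range W)) (scalar_mats m)"
    and B: "B \<in> orth_compl_in (mat_span m (range V)) (scalar_mats m)"
  note RW = proj_rep_range[OF weyl_proj_rep[OF W]]
  have A': "A \<in> mat_span m (range W)" and B': "B \<in> mat_span m (range V)"
    using A B by (auto simp: orth_compl_in_def)
  have Ac: "A \<in> carrier_mat m m" using mat_span_carrier[OF A' RW] .
  have adj1: "mat_adjoint (1\<^sub>m m :: complex mat) = 1\<^sub>m m" by (rule eq_matI) auto
  have "1 \<cdot>\<^sub>m 1\<^sub>m m \<in> scalar_mats m" unfolding scalar_mats_def by blast
  moreover have "1 \<cdot>\<^sub>m 1\<^sub>m m = (1\<^sub>m m :: complex mat)" by (rule eq_matI) auto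
  ultimately have "trace_inner (1\<^sub>m m) A = 0" using A by (auto simp: orth_compl_in_def)
  then have "mat_trace A = 0" using Ac by (simp add: trace_inner_def adj1)
  then have tr: "mat_trace (mat_adjoint A) = 0" using mat_trace_adjoint[OF Ac] by simp
  have "mat_adjoint A \<in> mat_span m (range W)"
    using weyl_span_star_subalgebra[OF weyl_proj_rep[OF W]] A' by (auto simp: star_subalgebra_def)
  from orth_span[OF W V o this B'] have "of_nat m * mat_trace (mat_adjoint A * B) = 0" by (simp add: tr)
  then show "trace_inner A B = 0" using W by (simp add: trace_inner_def weyl_def)
qed

text \<open>If the spans agreed, the traceless unitary \<open>W ?u\<close> could be paired with its
  own inverse, and the trace of the identity would vanish. This guarantees that distinct indices
  give distinct algebras.\<close>

lemma orth_span_neq: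
  assumes W: "weyl m c W" and V: "weyl m d V" and o: "orth m W V"
  shows "mat_span m (range W) \<noteq> mat_span m (range V)"
proof
  assume eq: "mat_span m (range W) = mat_span m (range V)"
  let ?u = "(1, 0) :: 'r \<times> 'r"
  have u: "?u \<notin> null" using one_notin by simp
  have "W (- ?u) \<in> mat_span m (range V)" unfolding eq[symmetric] by (auto intro: mat_span.gen)
  moreover have "W ?u \<in> mat_span m (range W)" by (auto intro: mat_span.gen)
  ultimately have "of_nat m * mat_trace (W ?u * W (- ?u)) = mat_trace (W ?u) * mat_trace (W (- ?u))"
    by (intro orth_span[OF W V o])
  also have "\<dots> = 0" using weyl_trace[OF W u] by simp
  also have "W ?u * W (- ?u) = \<psi> (c * sympl ?u (- ?u)) \<cdot>\<^sub>m 1\<^sub>m m"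
    using proj_rep_null[OF weyl_proj_rep[OF W], of "?u + - ?u"]
    by (simp add: proj_rep_mult[OF weyl_proj_rep[OF W]] null_iff)
  also have "sympl ?u (- ?u) = 0" by (simp add: sympl_def)
  finally show False using W by (simp add: weyl_def mat_trace_smult[of _ m])
qed

lemma orth_sym:
  assumes W: "proj_rep m c W" and V: "proj_rep m d V" and "orth m W V"
  shows "orth m V W"
  using assms(3) mat_trace_mult_commute[OF proj_rep_carrier[OF W] proj_rep_carrier[OF V]]
  by (simp add: orth_def mult.commute)

text \<open>Unless both arguments are null, the product of the traces of the first factors vanishes
  and, by orthogonality, so does the trace of their product. For null arguments the second factors
  are identities.\<close>

lemma orth_kron:
  assumes W: "weyl m c W" and W': "weyl m c' W'" and V: "proj_rep n d V" and V': "proj_rep n d' V'"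
    and o: "orth m W W'"
  shows "orth (m * n) (\<lambda>u. kron (W u) (V u)) (\<lambda>u. kron (W' u) (V' u))"
  unfolding orth_def
proof (intro allI)
  fix u v
  note Wc = proj_rep_carrier[OF weyl_proj_rep[OF W]] and Wc' = proj_rep_carrier[OF weyl_proj_rep[OF W']]
  note Vc = proj_rep_carrier[OF V] and Vc' = proj_rep_carrier[OF V']
  have WW: "of_nat m * mat_trace (W u * W' v) = mat_trace (W u) * mat_trace (W' v)"
    by (rule orthD[OF o])
  have tr: "mat_trace (kron (W u) (V u) * kron (W' v) (V' v)) = mat_trace (W u * W' v) * mat_trace (V u * V' v)"
    by (simp add: kron_mult[OF Wc Vc Wc' Vc'] mat_trace_kron[OF mult_carrier_mat[OF Wc Wc'] mult_carrier_mat[OF Vc Vc']])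
  have "of_nat (m * n) * mat_trace (kron (W u) (V u) * kron (W' v) (V' v)) =
      of_nat n * (of_nat m * mat_trace (W u * W' v)) * mat_trace (V u * V' v)"
    by (simp add: tr)
  also have "\<dots> = mat_trace (W u) * mat_trace (V u) * (mat_trace (W' v) * mat_trace (V' v))"
  proof (cases "u \<in> null \<and> v \<in> null")
    case True
    then show ?thesis by (simp add: WW proj_rep_null[OF V] proj_rep_null[OF V'])
  next
    case False
    then have "mat_trace (W u) * mat_trace (W' v) = 0"
      using weyl_trace[OF W, of u] weyl_trace[OF W', of v] by (cases "u \<in> null") simp_all
    then show ?thesis unfolding WW by auto
  qed
  finally show "of_nat (m * n) * mat_trace (kron (W u) (V u) * kron (W' v) (V' v)) =
      mat_trace (kron (W u) (V u)) * mat_trace (kron (W' v) (V' v))"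
    by (simp add: mat_trace_kron[OF Wc Vc] mat_trace_kron[OF Wc' Vc'])
qed

text \<open>The product \<open>W u * W v\<close> is traceless unless \<open>v\<close> is congruent
  to \<open>- u\<close>, so the second factors need to be compared only at opposite
  arguments.\<close>

lemma orth_kron_same:
  assumes W: "weyl m c W" and V: "proj_rep n d V" and V': "proj_rep n d' V'"
    and tr: "\<And>u. u \<notin> null \<Longrightarrow> mat_trace (V u * V' (- u)) = 0"
  shows "orth (m * n) (\<lambda>u. kron (W u) (V u)) (\<lambda>u. kron (W u) (V' u))"
  unfolding orth_def
proof (intro allI)
  fix u v
  note Wc = proj_rep_carrier[OF weyl_proj_rep[OF W]]
  note Vc = proj_rep_carrier[OF V] and Vc' = proj_rep_carrier[OF V']
  have "of_nat (m * n) * (mat_trace (W u * W v) * mat_trace (V u * V' v)) =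
      mat_trace (W u) * mat_trace (V u) * (mat_trace (W v) * mat_trace (V' v))"
  proof (cases "u + v \<in> null")
    case False
    then have "u \<notin> null \<or> v \<notin> null" using null_add by blast
    then have "mat_trace (W u) = 0 \<or> mat_trace (W v) = 0" using weyl_trace[OF W] by blast
    then show ?thesis using weyl_trace_mult[OF W False] by auto
  next
    case uv: True
    show ?thesis
    proof (cases "u \<in> null")
      case True
      then have "v \<in> null" using null_add_iff[OF uv] by simp
      with True show ?thesis
        by (simp add: proj_rep_null[OF weyl_proj_rep[OF W]] proj_rep_null[OF V] proj_rep_null[OF V'])
    next
      case False
      have "v - (- u) \<in> null" using uv by (simp add: add.commute)
      then have "V' v = V' (- u)" by (rule proj_rep_cong[OF V'])
      then show ?thesis using tr[OF False] weyl_trace[OF W False] by simp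
    qed
  qed
  then show "of_nat (m * n) * mat_trace (kron (W u) (V u) * kron (W v) (V' v)) =
      mat_trace (kron (W u) (V u)) * mat_trace (kron (W v) (V' v))"
    by (simp add: kron_mult[OF Wc Vc Wc Vc'] mat_trace_kron[OF Wc Vc] mat_trace_kron[OF Wc Vc']
        mat_trace_kron[OF mult_carrier_mat[OF Wc Wc] mult_carrier_mat[OF Vc Vc']])
qed

text \<open>For \<open>u\<close> outside \<open>null\<close> both sides vanish with the trace of
  \<open>W u\<close>; otherwise \<open>V u\<close> is the identity.\<close>

lemma orth_kron_one:
  assumes W: "weyl m c W" and V: "proj_rep n d V" and V': "proj_rep n d' V'"
  shows "orth (m * n) (\<lambda>u. kron (W u) (V u)) (\<lambda>u. kron (1\<^sub>m m) (V' u))"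
  unfolding orth_def
proof (intro allI)
  fix u v
  note Wc = proj_rep_carrier[OF weyl_proj_rep[OF W]]
  note Vc = proj_rep_carrier[OF V] and Vc' = proj_rep_carrier[OF V']
  have I: "(1\<^sub>m m :: complex mat) \<in> carrier_mat m m" by simp
  have "of_nat (m * n) * (mat_trace (W u) * mat_trace (V u * V' v)) =
      mat_trace (W u) * mat_trace (V u) * (of_nat m * mat_trace (V' v))"
  proof (cases "u \<in> null")
    case True
    then show ?thesis using Vc'[of v] by (simp add: proj_rep_null[OF V])
  next
    case False
    then show ?thesis using weyl_trace[OF W] by simp
  qed
  then show "of_nat (m * n) * mat_trace (kron (W u) (V u) * kron (1\<^sub>m m) (V' v)) =
      mat_trace (kron (W u) (V u)) * mat_trace (kron (1\<^sub>m m) (V' v))"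
    using Wc[of u]
    by (simp add: kron_mult[OF Wc Vc I Vc'] mat_trace_kron[OF Wc Vc] mat_trace_kron[OF I Vc']
        mat_trace_kron[OF Wc mult_carrier_mat[OF Vc Vc']])
qed

subsection \<open>The orthogonal family\<close>

text \<open>Squaring identifies the distinct classes of 1 and -1, so it is not injective on the
  finite set of classes and therefore not surjective.\<close>

lemma ex_nonsquare: "\<exists>d. \<forall>x. x ^ 2 - d \<notin> M"
proof -
  define s where "s i = idx (rep i ^ 2)" for i
  have "\<not> inj_on s {..<q}"
  proof
    assume inj: "inj_on s {..<q}"
    define a b where "a = idx 1" and "b = idx (- 1)"
    have a: "a < q" "1 - rep a \<in> M" and b: "b < q" "- 1 - rep b \<in> M" using idx by (auto simp: a_def b_def)
    have "rep a ^ 2 - rep b ^ 2 = (- 1 - rep b) * (rep b - 1) - (1 - rep a) * (1 + rep a)"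
      by (simp add: algebra_simps power2_eq_square)
    also have "\<dots> \<in> M" by (intro M_diff M_mult_right a b)
    finally have "s a = s b" unfolding s_def
      using idx_eqI[of "idx (rep b ^ 2)" "rep a ^ 2"] idx[of "rep b ^ 2"]
        M_add[of "rep a ^ 2 - rep b ^ 2" "rep b ^ 2 - rep (idx (rep b ^ 2))"] by simp
    with inj a b have "a = b" by (auto dest: inj_onD)
    then have "2 \<in> M" using M_diff[OF a(2) b(2)] by simp
    with two_notin show False ..
  qed
  moreover have "s ` {..<q} \<subseteq> {..<q}" using idx by (auto simp: s_def)
  ultimately have "s ` {..<q} \<noteq> {..<q}"
    by (metis card_lessThan eq_card_imp_inj_on finite_lessThan)
  with \<open>s ` {..<q} \<subseteq> {..<q}\<close> obtain i where i: "i < q" "i \<notin> s ` {..<q}" by blast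
  have "x ^ 2 - rep i \<notin> M" for x
  proof
    assume x: "x ^ 2 - rep i \<in> M"
    define j where "j = idx x"
    have j: "j < q" "x - rep j \<in> M" using idx by (auto simp: j_def)
    have "rep j ^ 2 - rep i = (x ^ 2 - rep i) - (x - rep j) * (x + rep j)"
      by (simp add: algebra_simps power2_eq_square)
    also have "\<dots> \<in> M" by (intro M_diff[OF x] M_mult_right j)
    finally have "s j = i" unfolding s_def by (rule idx_eqI[OF i(1)])
    with i(2) j(1) show False by blast
  qed
  then show ?thesis by blast
qed

section \<open>Norm and twisted multiplication in the quadratic extension\<close>

text \<open>
  A pair \<open>(x, y)\<close> stands for \<open>x + y \<surd>d\<close> in the quadratic extension by a non-square \<open>d\<close>; then
  \<open>qmult d 1 a u\<close> is \<open>a u\<close>, and \<open>qmult d (- 1) a u\<close> is \<open>a\<close> times the conjugate of \<open>u\<close>.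
\<close>

definition qnorm :: "'r \<Rightarrow> 'r \<times> 'r \<Rightarrow> 'r" where
  "qnorm d a = fst a ^ 2 - d * snd a ^ 2"

definition qmult :: "'r \<Rightarrow> 'r \<Rightarrow> 'r \<times> 'r \<Rightarrow> 'r \<times> 'r \<Rightarrow> 'r \<times> 'r" where
  "qmult d e a u = (fst a * fst u + e * (d * snd a * snd u), snd a * fst u + e * (fst a * snd u))"

lemma qmult_add: "qmult d e a (u + v) = qmult d e a u + qmult d e a v"
  by (simp add: qmult_def algebra_simps prod_eq_iff)

lemma qmult_minus: "qmult d e a (- u) = - qmult d e a u"
  by (simp add: qmult_def algebra_simps prod_eq_iff)

lemma qmult_diff_left: "qmult d e a u - qmult d e b u = qmult d e (a - b) u"
  by (simp add: qmult_def algebra_simps prod_eq_iff)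

lemma qmult_null: "u \<in> null \<Longrightarrow> qmult d e a u \<in> null"
  by (simp add: qmult_def null_iff M_add M_mult)

text \<open>The factor \<open>e * qnorm d a\<close> is the determinant of the linear map
  \<open>qmult d e a\<close> on the plane.\<close>

lemma sympl_qmult: "sympl (qmult d e a u) (qmult d e a v) = (e * qnorm d a) * sympl u v"
  by (simp add: sympl_def qmult_def qnorm_def algebra_simps power2_eq_square)

text \<open>Multiplicativity of the norm; conjugation does not affect it because \<open>e\<close>
  enters only through its square.\<close>

lemma qnorm_qmult: "e * e = 1 \<Longrightarrow> qnorm d (qmult d e a u) = qnorm d a * qnorm d u"
proof -
  assume e: "e * e = 1"
  have "qnorm d (qmult d e a u) = qnorm d a * (fst u ^ 2 - (e * e) * (d * snd u ^ 2))"
    by (simp add: qmult_def qnorm_def algebra_simps power2_eq_square)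
  then show ?thesis by (simp add: e qnorm_def)
qed

lemma qnorm_cong: "u - v \<in> null \<Longrightarrow> qnorm d u - qnorm d v \<in> M"
proof -
  assume uv: "u - v \<in> null"
  have "qnorm d u - qnorm d v =
      fst (u - v) * (fst u + fst v) - snd (u - v) * (d * (snd u + snd v))"
    by (simp add: qnorm_def algebra_simps power2_eq_square)
  also have "\<dots> \<in> M" using uv by (intro M_diff M_mult_right) (auto simp: null_iff)
  finally show ?thesis .
qed

text \<open>If \<open>snd u\<close> were invertible, dividing \<open>fst u\<close> by it would give
  a square root of \<open>d\<close>. With \<open>snd u\<close> in \<open>M\<close>, the square of
  \<open>fst u\<close> lies in \<open>M\<close> as well.\<close>

lemma qnorm_anisotropic:
  assumes d: "\<And>x. x ^ 2 - d \<notin> M" and u: "qnorm d u \<in> M"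
  shows "u \<in> null"
proof -
  have y: "snd u \<in> M"
  proof (rule ccontr)
    assume "snd u \<notin> M"
    then obtain b where b: "1 - b * snd u \<in> M" using inverse_ex by blast
    have "(b * fst u) ^ 2 - d = b ^ 2 * qnorm d u - (1 - b * snd u) * (d * (1 + b * snd u))"
      by (simp add: qnorm_def algebra_simps power2_eq_square)
    also have "\<dots> \<in> M" by (intro M_diff M_mult u M_mult_right b)
    finally show False using d by blast
  qed
  have "fst u * fst u = qnorm d u + d * snd u * snd u"
    by (simp add: qnorm_def power2_eq_square mult.assoc)
  also have "\<dots> \<in> M" by (intro M_add u M_mult y)
  finally have "fst u \<in> M" using M_prime by blast
  with y show ?thesis by (simp add: null_iff)
qed

text \<open>
  Conjugation flips the sign of the norm, so it is used exactly when the parameter \<open>c + N(a)\<close>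
  of the untwisted tensor product would vanish. This is where an odd characteristic is needed.
\<close>

definition sgn_choice :: "'r \<Rightarrow> 'r \<Rightarrow> 'r \<times> 'r \<Rightarrow> 'r" where
  "sgn_choice d c a = (if c + qnorm d a \<in> M then - 1 else 1)"

lemma sgn_choice_square: "sgn_choice d c a * sgn_choice d c a = 1"
  by (simp add: sgn_choice_def)

lemma sgn_choice_nondegenerate:
  assumes "c \<notin> M"
  shows "c + sgn_choice d c a * qnorm d a \<notin> M"
proof
  assume h: "c + sgn_choice d c a * qnorm d a \<in> M"
  then have "c + qnorm d a \<in> M" "c - qnorm d a \<in> M"
    by (cases "c + qnorm d a \<in> M"; simp add: sgn_choice_def)+
  moreover have "c + qnorm d a + (c - qnorm d a) = 2 * c" by (simp add: algebra_simps)
  ultimately have "2 * c \<in> M" using M_add by metis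
  then show False using M_prime[OF _ two_notin] assms by blast
qed

definition twist :: "'r \<Rightarrow> 'r \<Rightarrow> 'r \<times> 'r \<Rightarrow> 'r \<times> 'r \<Rightarrow> 'r \<times> 'r" where
  "twist d c a = qmult d (sgn_choice d c a) a"

text \<open>For equal signs the difference of the images is the product of \<open>a - b\<close> with
  \<open>u\<close> or its conjugate, and its norm is that of \<open>a - b\<close> times that of
  \<open>u\<close>. Different signs mean that exactly one of \<open>c + qnorm d a\<close> and
  \<open>c + qnorm d b\<close> is in \<open>M\<close>, so \<open>a\<close> and \<open>b\<close> have
  different norms and the images can agree only if \<open>u\<close> has norm zero.\<close>

lemma twist_separates:
  assumes d: "\<And>x. x ^ 2 - d \<notin> M" and ab: "a - b \<notin> null" and eq: "twist d c a u - twist d c b u \<in> null"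
  shows "u \<in> null"
proof -
  have prime: "u \<in> null" if "r \<notin> M" "r * qnorm d u \<in> M" for r
    using qnorm_anisotropic[OF d] M_prime that by blast
  show ?thesis
  proof (cases "sgn_choice d c a = sgn_choice d c b")
    case True
    then have "qmult d (sgn_choice d c a) (a - b) u \<in> null"
      using eq by (simp only: twist_def flip: qmult_diff_left)
    then have "qmult d (sgn_choice d c a) (a - b) u - 0 \<in> null" by simp
    from qnorm_cong[OF this, of d] have "qnorm d (a - b) * qnorm d u \<in> M"
      by (simp only: qnorm_qmult[OF sgn_choice_square]) (simp add: qnorm_def[of d 0])
    moreover have "qnorm d (a - b) \<notin> M" using qnorm_anisotropic[OF d] ab by blast
    ultimately show ?thesis using prime by blast
  next
    case False
    then have "qnorm d a - qnorm d b \<notin> M"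
      using M_cong_diff[of "c + qnorm d a" "c + qnorm d b"] by (auto simp: sgn_choice_def split: if_splits)
    moreover have "(qnorm d a - qnorm d b) * qnorm d u \<in> M"
      using qnorm_cong[OF eq, of d]
      by (simp only: twist_def qnorm_qmult[OF sgn_choice_square] left_diff_distrib)
    ultimately show ?thesis by (rule prime)
  qed
qed

lemma proj_rep_twist:
  "proj_rep q (sgn_choice d c a * qnorm d a) (\<lambda>u. schroedinger (twist d c a u))"
  using proj_rep_comp[OF proj_rep_schroedinger, of "twist d c a" "sgn_choice d c a * qnorm d a"]
  by (simp only: twist_def qmult_add qmult_null sympl_qmult mult_1)

lemma orth_twist:
  assumes d: "\<And>x. x ^ 2 - d \<notin> M" and W: "weyl m c W" and ab: "a - b \<notin> null"
  shows "orth (m * q) (\<lambda>u. kron (W u) (schroedinger (twist d c a u)))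
    (\<lambda>u. kron (W u) (schroedinger (twist d c b u)))"
proof (rule orth_kron_same[OF W proj_rep_twist proj_rep_twist])
  fix u assume "u \<notin> null"
  then have "twist d c a u + twist d c b (- u) \<notin> null"
    using twist_separates[OF d ab, of c u] by (auto simp: twist_def qmult_minus)
  then show "mat_trace (schroedinger (twist d c a u) * schroedinger (twist d c b (- u))) = 0"
    by (rule weyl_trace_mult[OF weyl_schroedinger])
qed

section \<open>Inductive construction of the family and its size\<close>

primrec family_size :: "nat \<Rightarrow> nat" where
  "family_size 0 = 0"
| "family_size (Suc n) = family_size n * q ^ 2 + 1"

text \<open>The recursion is Horner's rule for the geometric sum of the first \<open>n\<close>
  powers of \<open>q ^ 2\<close>.\<close>

lemma family_size_closed: "family_size n * (q ^ 2 - 1) = q ^ (2 * n) - 1"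
proof (induction n)
  case (Suc n)
  have 1: "q ^ 2 \<ge> 1" "q ^ (2 * n) \<ge> 1" using q_pos by simp_all
  have "family_size (Suc n) * (q ^ 2 - 1) = (family_size n * (q ^ 2 - 1)) * q ^ 2 + (q ^ 2 - 1)"
    by (simp add: algebra_simps)
  also have "\<dots> = (q ^ (2 * n) - 1) * q ^ 2 + (q ^ 2 - 1)" by (simp only: Suc)
  also have "\<dots> = q ^ (2 * n) * q ^ 2 - 1" using 1 by (simp add: diff_mult_distrib)
  also have "q ^ (2 * n) * q ^ 2 = q ^ (2 * Suc n)" by (simp flip: power_add)
  finally show ?case .
qed simp

lemma orthogonal_weyl_family:
  assumes d: "\<And>x. x ^ 2 - d \<notin> M"
  shows "\<exists>W c. (\<forall>i<family_size n. weyl (q ^ n) (c i) (W i)) \<and>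
    (\<forall>i<family_size n. \<forall>j<family_size n. i \<noteq> j \<longrightarrow> orth (q ^ n) (W i) (W j))"
proof (induction n)
  case (Suc n)
  then obtain W c where W: "\<And>i. i < family_size n \<Longrightarrow> weyl (q ^ n) (c i) (W i)"
    and o: "\<And>i j. i < family_size n \<Longrightarrow> j < family_size n \<Longrightarrow> i \<noteq> j \<Longrightarrow> orth (q ^ n) (W i) (W j)" by blast
  let ?Q = "q ^ 2"
  have Q: "?Q = q * q" by (simp add: power2_eq_square)
  \<comment> \<open>An index \<open>i < bound\<close> encodes the old system \<open>i div ?Q\<close>
    and, by the two base \<open>q\<close> digits of \<open>i mod ?Q\<close>, an element
    \<open>a i\<close> of the plane.\<close>
  define a where "a i = (rep (i mod ?Q div q), rep (i mod ?Q mod q))" for i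
  define V where "V i = schroedinger \<circ> twist d (c (i div ?Q)) (a i)" for i
  define bound where "bound = family_size n * ?Q"
  define X where "X i = (if i < bound then (\<lambda>u. kron (W (i div ?Q) u) (V i u))
      else (\<lambda>u. kron (1\<^sub>m (q ^ n)) (schroedinger u)))" for i
  \<comment> \<open>The unsimplified \<open>0 + 1\<close> adds the parameters of the trivial and the
    standard system, in the form delivered by \<open>weyl_kron\<close>.\<close>
  define e where "e i = (if i < bound then c (i div ?Q) + sgn_choice d (c (i div ?Q)) (a i) * qnorm d (a i)
      else 0 + 1)" for i
  have quot: "i div ?Q < family_size n" if "i < bound" for i
    using that div_mod_less_mult(1) by (simp add: bound_def)
  have V: "proj_rep q (sgn_choice d (c (i div ?Q)) (a i) * qnorm d (a i)) (V i)" for i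
    using proj_rep_twist unfolding V_def comp_def .
  have qn: "q ^ n > 0" using q_pos by simp
  have size: "family_size (Suc n) = Suc bound" by (simp add: bound_def)
  have dim: "q ^ Suc n = q ^ n * q" by simp
  have weyl_X: "weyl (q ^ Suc n) (e i) (X i)" for i
  proof (cases "i < bound")
    case True
    note Wi = W[OF quot[OF True]]
    have "c (i div ?Q) \<notin> M" using Wi by (simp add: weyl_def)
    then show ?thesis
      unfolding dim using True weyl_kron[OF weyl_proj_rep[OF Wi] V sgn_choice_nondegenerate qn q_pos] weyl_trace[OF Wi]
      by (simp add: X_def e_def)
  next
    case False
    then show ?thesis
      unfolding dim using weyl_kron[OF proj_rep_trivial proj_rep_schroedinger _ qn q_pos]
        weyl_trace[OF weyl_schroedinger] one_notin by (simp add: X_def e_def)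
  qed
  \<comment> \<open>With \<open>i < j\<close> the additional system of index \<open>bound\<close>
    can occur only as the second argument. Systems from different old ones inherit orthogonality;
    those from the same old one rely on the twists.\<close>
  have orth_less: "orth (q ^ Suc n) (X i) (X j)" if ij: "i < j" "j < Suc bound" for i j
  proof (cases "j < bound")
    case False
    have i: "i < bound" using ij by simp
    show ?thesis
      unfolding dim X_def using i False orth_kron_one[OF W[OF quot[OF i]] V proj_rep_schroedinger] by simp
  next
    case True
    then have i: "i < bound" using ij by simp
    show ?thesis
    proof (cases "i div ?Q = j div ?Q")
      case False
      show ?thesis
        unfolding dim X_def using i True orth_kron[OF W[OF quot[OF i]] W[OF quot[OF True]] V V o[OF quot[OF i] quot[OF True] False]]
        by simp
    next
      case eq: True
      have "a i - a j \<notin> null"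
      proof
        assume n: "a i - a j \<in> null"
        have Qpos: "?Q > 0" using q_pos by simp
        have l: "k mod ?Q < q * q" for k using Qpos by (simp flip: Q)
        have "i mod ?Q div q = j mod ?Q div q" "i mod ?Q mod q = j mod ?Q mod q"
          using n div_mod_less_mult[OF l[of i]] div_mod_less_mult[OF l[of j]]
          by (auto simp: a_def null_iff intro!: rep_inj)
        then have "i mod ?Q = j mod ?Q" by (metis div_mod_decomp)
        with eq have "i = j" by (metis div_mod_decomp)
        with ij show False by simp
      qed
      from orth_twist[OF d W[OF quot[OF i]] this] show ?thesis
        unfolding dim X_def V_def using i True eq by simp
    qed
  qed
  have "orth (q ^ Suc n) (X i) (X j)" if "i < Suc bound" "j < Suc bound" "i \<noteq> j" for i j
    using that orth_less[of i j] orth_sym[OF weyl_proj_rep[OF weyl_X] weyl_proj_rep[OF weyl_X] orth_less[of j i]]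
    by (cases "i < j") auto
  with weyl_X show ?case unfolding size by blast
qed auto

lemma quasi_orthogonal_family:
  "\<exists>\<F>. finite \<F> \<and> card \<F> = family_size n \<and>
    (\<forall>\<A>\<in>\<F>. star_subalgebra (q ^ n) \<A> \<and> star_isomorphic \<A> (carrier_mat q q)) \<and>
    pairwise (quasi_orthogonal (q ^ n)) \<F>"
proof -
  obtain d where d: "\<And>x. x ^ 2 - d \<notin> M" using ex_nonsquare by blast
  obtain W c where W: "\<And>i. i < family_size n \<Longrightarrow> weyl (q ^ n) (c i) (W i)"
    and o: "\<And>i j. i < family_size n \<Longrightarrow> j < family_size n \<Longrightarrow> i \<noteq> j \<Longrightarrow> orth (q ^ n) (W i) (W j)"
    using orthogonal_weyl_family[OF d, of n] by blast
  let ?A = "\<lambda>i. mat_span (q ^ n) (range (W i))"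
  have "inj_on ?A {..<family_size n}"
  proof (rule inj_onI)
    fix i j assume "i \<in> {..<family_size n}" "j \<in> {..<family_size n}" "?A i = ?A j"
    then show "i = j" using orth_span_neq[OF W W o, of i j] by (cases "i = j") auto
  qed
  then have "card (?A ` {..<family_size n}) = family_size n" by (simp add: card_image)
  moreover have "pairwise (quasi_orthogonal (q ^ n)) (?A ` {..<family_size n})"
  proof (rule pairwiseI)
    fix A B assume "A \<in> ?A ` {..<family_size n}" "B \<in> ?A ` {..<family_size n}" "A \<noteq> B"
    then obtain i j where "A = ?A i" "B = ?A j" "i < family_size n" "j < family_size n" "i \<noteq> j" by auto
    then show "quasi_orthogonal (q ^ n) A B" using orth_quasi_orthogonal[OF W W o] by simp
  qed
  ultimately show ?thesis
    using weyl_span_star_subalgebra[OF weyl_proj_rep[OF W]] weyl_span_star_isomorphic_full[OF W]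
    by (intro exI[of _ "?A ` {..<family_size n}"]) auto
qed

end

theorem theorem3p5:
  fixes p k n :: nat
  assumes "prime p" and "p \<ge> 3" and "k \<ge> 1" and "n \<ge> 1"
  shows "\<exists>\<F> :: complex mat set set.
    finite \<F> \<and> card \<F> = N_sub p k n \<and>
    (\<forall>\<A>\<in>\<F>. star_subalgebra (p ^ (k * n)) \<A> \<and>
             star_isomorphic \<A> (carrier_mat (p ^ k) (p ^ k))) \<and>
    pairwise (quasi_orthogonal (p ^ (k * n))) \<F>"
proof -
  obtain M :: "int poly set" and rep where M: "submodule_over UNIV M" "1 \<notin> M" "of_nat p \<in> M"
    and inv: "\<And>f. f \<notin> M \<Longrightarrow> \<exists>g. 1 - g * f \<in> M"
    and rep: "\<And>f. \<exists>i<p ^ k. f - rep i \<in> M"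
      "\<And>i j. i < p ^ k \<Longrightarrow> j < p ^ k \<Longrightarrow> rep i - rep j \<in> M \<Longrightarrow> i = j"
    using finite_field_quotient[OF assms(1-3)] by metis
  obtain \<psi> :: "int poly \<Rightarrow> complex" where \<psi>: "\<And>a b. \<psi> (a + b) = \<psi> a * \<psi> b"
    "\<And>a. cnj (\<psi> a) = \<psi> (- a)" "\<And>a. a \<in> M \<Longrightarrow> \<psi> a = 1" "\<psi> 1 \<noteq> 1"
    using additive_character_mod_ideal[OF assms(1) M] by metis
  \<comment> \<open>With \<open>p = 2 * r + 1\<close>, membership of both \<open>p\<close> and 2
    would put \<open>1 = p - 2 * r\<close> into \<open>M\<close>.\<close>
  have two: "2 \<notin> M"
  proof
    assume "2 \<in> M"
    have "odd p" using assms(1,2) prime_odd_nat[of p] by simp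
    then obtain r where r: "p = 2 * r + 1" by (elim oddE)
    have "of_nat r * 2 \<in> M" using M(1) \<open>2 \<in> M\<close> by (simp add: submodule_over_def)
    then have "(- 1) * (of_nat r * 2) \<in> M" using M(1) unfolding submodule_over_def by blast
    then have "of_nat p + (- 1) * (of_nat r * 2) \<in> M" using M(1,3) unfolding submodule_over_def by blast
    then show False using M(2) by (simp add: r)
  qed
  interpret residue_field M "p ^ k" rep \<psi>
    by unfold_locales (use M inv rep \<psi> two in auto)
  \<comment> \<open>This makes the divisor in \<open>N_sub\<close> positive, so it can be cancelled
    in \<open>family_size_closed\<close>.\<close>
  have "(p ^ k) ^ 2 > 1" unfolding power_mult[symmetric] by (rule one_less_power) (use assms in auto)
  then have "family_size n = N_sub p k n"
    using family_size_closed[of n] unfolding N_sub_def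
    by (metis (no_types, lifting) mult.commute mult.left_commute nonzero_mult_div_cancel_right power_mult zero_less_diff less_irrefl)
  with quasi_orthogonal_family[of n] show ?thesis by (simp add: power_mult)
qed

end
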